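(* Let $W_G(q_1,q_2,\dots)$ denote the weighted chromatic polynomial of a simple graph $G$, and put $$\mathcal{W}(q_1,q_2,\dots)=\sum_{G\text{ connected}}\frac{W_G(q_1,q_2,\dots)}{|\mathrm{Aut}(G)|},\qquad \mathcal{W}^\circ(q_1,q_2,\dots)=\exp(\mathcal{W})=\sum_{G}\frac{W_G(q_1,q_2,\dots)}{|\mathrm{Aut}(G)|},$$ where the first sum runs over isomorphism classes of non-empty connected simple graphs and the last sum over isomorphism classes of all simple graphs (possibly disconnected, possibly empty). Let the sequence $(c_n)_{n\ge1}$ be defined by $$c_1=1,\qquad c_n=(-1)^{n+1}\left[1+\sum_{k=1}^{n-1}(-1)^k2^{k(n-k)}\binom{n-1}{k-1}c_k\right].$$ Then after the substitution $$q_n=\frac{2^{n(n-1)/2}(n-1)!}{c_n}\,p_n\qquad(n=1,2,\dots)$$ the generating function $\mathcal{W}$ becomes a solution (in the variables $p_1,p_2,\dots$) to the KP hierarchy of partial differential equations, and $\mathcal{W}^\circ$ becomes a $\tau$-function of the KP hierarchy.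
   Context: Graphs are finite; a simple graph has no loops or multiple edges. $\mathrm{Aut}(G)$ is the automorphism group of $G$ and $|\mathrm{Aut}(G)|$ its order. The empty graph is not counted as connected. Weighted chromatic polynomial. A weighted graph is a simple graph $G$ with a weight function $w:V(G)\to\{1,2,3,\dots\}$. To every weighted graph one assigns a polynomial $W_G\in\mathbb{C}[q_1,q_2,\dots]$ determined by: (i) if $G$ has no edges, $W_G=\prod_{v\in V(G)}q_{w(v)}$ (so $W=1$ for the empty graph); (ii) for every edge $e$ of $G$, $W_G=W_{G'_e}+W_{G''_e}$, where $G'_e$ is $G$ with $e$ deleted and $G''_e$ is $G$ with $e$ contracted, multiple edges that arise being replaced by single edges, the weight of the new vertex being the sum of the weights of the two ends of $e$, and the other weights being unchanged. For an ordinary simple graph, $W_G$ is defined by giving every vertex weight $1$. Equivalently, for a simple graph $G$, $W_G=\sum_{E'\subseteq E(G)}(-1)^{|E'|-|V(G)|+k(E')}q_{v_1}\cdots q_{v_k}$, where $k=k(E')$ is the number of connected components of the spanning subgraph $(V(G),E')$ and $v_1,\dots,v_k$ are the numbers of vertices of these components. KP hierarchy. Define one-part Schur polynomials $s_n(p_1,p_2,\dots)$ by $\sum_{n\ge0}s_n=\exp\left(\sum_{k\ge1}p_k/k\right)$ ($s_n$ being the part of weighted degree $n$, with $p_i$ of degree $i$; $s_n=0$ for $n<0$), and for a partition $\lambda=(\lambda_1\ge\dots\ge\lambda_l)$ put $s_\lambda=\det(s_{\lambda_i-i+j})_{1\le i,j\le l}$. A $\tau$-function of the KP hierarchy is a formal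 power series in $p_1,p_2,\dots$ obtained as follows. Take formal Laurent series $\beta_i(z)=z^{-i}+c_{i1}z^{-i+1}+c_{i2}z^{-i+2}+\cdots$, $i=1,2,\dots$, and expand the semi-infinite wedge product $\beta_1\wedge\beta_2\wedge\beta_3\wedge\cdots=\sum_\mu c_\mu v_\mu$ over partitions $\mu$, where $v_\mu=z^{m_1}\wedge z^{m_2}\wedge\cdots$ with $m_i=\mu_i-i$ ($\mu_i=0$ for $i$ large); explicitly $c_\mu=\det\left([z^{\mu_j-j}]\beta_i\right)_{1\le i,j\le n}$ for any $n\ge$ the number of parts of $\mu$, so $c_\emptyset=1$. The corresponding $\tau$-function is $\sum_\mu c_\mu s_\mu(p_1,p_2,\dots)$. Solutions of the KP hierarchy are the logarithms of $\tau$-functions (the KP equations are the form taken by the Hirota, i.e. Plücker, equations for the coefficients $c_\mu$ when rewritten for the logarithm of the $\tau$-function; the first of them is $\frac{\partial^2F}{\partial p_2^2}=\frac{\partial^2F}{\partial p_1\partial p_3}-\frac12\left(\frac{\partial^2F}{\partial p_1^2}\right)^2-\frac1{12}\frac{\partial^4F}{\partial p_1^4}$). *)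

theory Defs
  imports
    "HOL-Library.Poly_Mapping"
    "HOL-Combinatorics.Permutations"
    "HOL-Computational_Algebra.Formal_Laurent_Series"
    "Jordan_Normal_Form.Determinant"
begin

section \<open>Formal power series in countably many variables\<close>

text \<open>A monomial is a finitely supported exponent vector \<open>nat \<Rightarrow>\<^sub>0 nat\<close>.  The variables of
  interest are those with index \<open>\<ge> 1\<close>; the variable with index \<open>0\<close> never occurs in the
  series considered below.\<close>

type_synonym monom = "nat \<Rightarrow>\<^sub>0 nat"

type_synonym mpoly = "monom \<Rightarrow>\<^sub>0 complex"

typedef mfps = "UNIV :: (monom \<Rightarrow> complex) set"
  morphisms mfps_nth Abs_mfps by simp

lemma mfps_nth_Abs [simp]: "mfps_nth (Abs_mfps f) = f"
  by (simp add: Abs_mfps_inverse)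

lemma mfps_eqI: "(\<And>m. mfps_nth F m = mfps_nth G m) \<Longrightarrow> F = G"
  using mfps_nth_inject by blast

definition splits :: "monom \<Rightarrow> (monom \<times> monom) set" where
  "splits m = {(a, b). a + b = m}"

lemma finite_splits [simp]: "finite (splits m)"
proof -
  let ?S = "PiE (Poly_Mapping.keys m) (\<lambda>i. {..Poly_Mapping.lookup m i})"
  let ?g = "\<lambda>(a, b). restrict (Poly_Mapping.lookup a) (Poly_Mapping.keys m)"
  have zero: "Poly_Mapping.lookup a i = 0" if "a + b = m" "i \<notin> Poly_Mapping.keys m" for a b i
    using that by (auto simp: in_keys_iff lookup_add)
  have "inj_on ?g (splits m)"
  proof (rule inj_onI, clarsimp simp: splits_def)
    fix a b a' b' :: monom
    assume ab: "a' + b' = a + b"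
      and eq: "restrict (Poly_Mapping.lookup a) (Poly_Mapping.keys (a + b))
             = restrict (Poly_Mapping.lookup a') (Poly_Mapping.keys (a + b))"
    have "a = a'"
    proof (rule poly_mapping_eqI)
      fix i
      show "Poly_Mapping.lookup a i = Poly_Mapping.lookup a' i"
      proof (cases "i \<in> Poly_Mapping.keys (a + b)")
        case True
        then show ?thesis using fun_cong[OF eq, of i] by simp
      next
        case False
        have "Poly_Mapping.lookup (a + b) i = 0"
          using False by (simp add: in_keys_iff)
        moreover have "Poly_Mapping.lookup (a' + b') i = 0"
          using False ab by (simp add: in_keys_iff)
        ultimately show ?thesis by (simp add: lookup_add)
      qed
    qed
    then show "a = a' \<and> b = b'" using ab by simp
  qed
  moreover have "?g ` splits m \<subseteq> ?S"
    by (auto simp: splits_def lookup_add)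
  moreover have "finite ?S" by (intro finite_PiE) auto
  ultimately show ?thesis by (meson finite_imageD finite_subset)
qed

instantiation mfps :: comm_ring_1
begin

definition "0 = Abs_mfps (\<lambda>_. 0)"
definition "1 = Abs_mfps (\<lambda>m. if m = 0 then 1 else 0)"
definition "F + G = Abs_mfps (\<lambda>m. mfps_nth F m + mfps_nth G m)"
definition "F - G = Abs_mfps (\<lambda>m. mfps_nth F m - mfps_nth G m)"
definition "- F = Abs_mfps (\<lambda>m. - mfps_nth F m)"
definition "F * G = Abs_mfps (\<lambda>m. \<Sum>(a, b)\<in>splits m. mfps_nth F a * mfps_nth G b)"

lemmas mfps_ring_defs = zero_mfps_def one_mfps_def plus_mfps_def minus_mfps_def
  uminus_mfps_def times_mfps_def

instance
proof
  fix F G H :: mfps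
  show "F + G + H = F + (G + H)" "F + G = G + F" "0 + F = F" "- F + F = 0" "F - G = F + - G"
    by (auto intro!: mfps_eqI simp: mfps_ring_defs)
  show "(0::mfps) \<noteq> 1"
  proof
    assume "(0::mfps) = 1"
    then have "mfps_nth 0 0 = mfps_nth 1 0" by simp
    then show False by (simp add: mfps_ring_defs)
  qed
  show "F * G = G * F"
    by (intro mfps_eqI, unfold mfps_ring_defs mfps_nth_Abs,
        intro sum.reindex_bij_witness[where i = prod.swap and j = prod.swap])
       (auto simp: splits_def add.commute mult.commute)
  show "(F + G) * H = F * H + G * H"
    by (intro mfps_eqI) (simp add: mfps_ring_defs case_prod_unfold algebra_simps sum.distrib)
  show "1 * F = F"
  proof (intro mfps_eqI)
    fix m
    have "mfps_nth (1 * F) m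
        = (\<Sum>x\<in>splits m. if x = (0, m) then mfps_nth F m else 0)"
      unfolding mfps_ring_defs mfps_nth_Abs
      by (intro sum.cong) (auto simp: splits_def split: if_splits)
    also have "\<dots> = mfps_nth F m"
      by (subst sum.delta[OF finite_splits]) (simp add: splits_def)
    finally show "mfps_nth (1 * F) m = mfps_nth F m" .
  qed
  show "F * G * H = F * (G * H)"
  proof (intro mfps_eqI)
    fix m
    let ?t = "\<lambda>a b c. mfps_nth F a * mfps_nth G b * mfps_nth H c"
    have "mfps_nth (F * G * H) m
        = (\<Sum>x\<in>splits m. \<Sum>y\<in>splits (fst x). ?t (fst y) (snd y) (snd x))"
      by (simp add: mfps_ring_defs case_prod_unfold sum_distrib_right)
    also have "\<dots> = (\<Sum>(x, y)\<in>Sigma (splits m) (\<lambda>x. splits (fst x)).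
        ?t (fst y) (snd y) (snd x))"
      by (subst sum.Sigma) auto
    also have "\<dots> = (\<Sum>(x, y)\<in>Sigma (splits m) (\<lambda>x. splits (snd x)).
        ?t (fst x) (fst y) (snd y))"
      by (rule sum.reindex_bij_witness[where
            i = "\<lambda>((a, r), (b, c)). ((a + b, c), (a, b))" and
            j = "\<lambda>((r, c), (a, b)). ((a, b + c), (b, c))"])
         (auto simp: splits_def add.assoc)
    also have "\<dots> = (\<Sum>x\<in>splits m. \<Sum>y\<in>splits (snd x). ?t (fst x) (fst y) (snd y))"
      by (subst sum.Sigma) auto
    also have "\<dots> = mfps_nth (F * (G * H)) m"
      by (simp add: mfps_ring_defs case_prod_unfold sum_distrib_left mult.assoc)
    finally show "mfps_nth (F * G * H) m = mfps_nth (F * (G * H)) m" .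
  qed
qed

end

definition mfps_smult :: "complex \<Rightarrow> mfps \<Rightarrow> mfps" where
  "mfps_smult c F = Abs_mfps (\<lambda>m. c * mfps_nth F m)"

definition mfps_var :: "nat \<Rightarrow> mfps" where
  "mfps_var i = Abs_mfps (\<lambda>m. if m = Poly_Mapping.single i 1 then 1 else 0)"

definition mfps_of_mpoly :: "mpoly \<Rightarrow> mfps" where
  "mfps_of_mpoly P = Abs_mfps (Poly_Mapping.lookup P)"

text \<open>The sum of a locally finite family of series (every monomial has a nonzero coefficient in
  only finitely many members of the family), which is the only case in which it is used.\<close>

definition formal_sum :: "'i set \<Rightarrow> ('i \<Rightarrow> mfps) \<Rightarrow> mfps" where
  "formal_sum A f = Abs_mfps (\<lambda>m. \<Sum>i | i \<in> A \<and> mfps_nth (f i) m \<noteq> 0. mfps_nth (f i) m)"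

text \<open>Exponential of a series without constant term, and logarithm of a series with constant
  term \<open>1\<close>.\<close>

definition mfps_exp :: "mfps \<Rightarrow> mfps" where
  "mfps_exp F = formal_sum UNIV (\<lambda>n::nat. mfps_smult (1 / fact n) (F ^ n))"

definition mfps_ln :: "mfps \<Rightarrow> mfps" where
  "mfps_ln T = formal_sum {1..} (\<lambda>n::nat. mfps_smult ((-1) ^ (n + 1) / of_nat n) ((T - 1) ^ n))"

text \<open>The substitution \<open>q\<^sub>n = a\<^sub>n p\<^sub>n\<close>, where the variables of the argument are the \<open>q\<^sub>n\<close> and those of
  the result are the \<open>p\<^sub>n\<close>.\<close>

definition rescale_vars :: "(nat \<Rightarrow> complex) \<Rightarrow> mfps \<Rightarrow> mfps" where
  "rescale_vars a F = Abs_mfps (\<lambda>m.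
     (\<Prod>i\<in>Poly_Mapping.keys m. a i ^ Poly_Mapping.lookup m i) * mfps_nth F m)"

definition wdeg :: "monom \<Rightarrow> nat" where
  "wdeg m = (\<Sum>i\<in>Poly_Mapping.keys m. i * Poly_Mapping.lookup m i)"

definition wdeg_part :: "nat \<Rightarrow> mfps \<Rightarrow> mfps" where
  "wdeg_part n F = Abs_mfps (\<lambda>m. if wdeg m = n then mfps_nth F m else 0)"


section \<open>The KP hierarchy\<close>

definition is_partition :: "nat list \<Rightarrow> bool" where
  "is_partition \<mu> \<longleftrightarrow> sorted_wrt (\<ge>) \<mu> \<and> 0 \<notin> set \<mu>"

definition schur1 :: "int \<Rightarrow> mfps" where
  "schur1 n = (if n < 0 then 0
     else wdeg_part (nat n)
            (mfps_exp (formal_sum {1..} (\<lambda>k::nat. mfps_smult (1 / of_nat k) (mfps_var k)))))"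

text \<open>Lists and matrices are indexed from \<open>0\<close>, so that part \<open>\<mu>\<^sub>j\<close> is \<open>\<mu> ! (j - 1)\<close>.\<close>

definition schur :: "nat list \<Rightarrow> mfps" where
  "schur \<mu> = det (mat (length \<mu>) (length \<mu>) (\<lambda>(i, j). schur1 (int (\<mu> ! i) - int i + int j)))"

text \<open>Coefficient of \<open>v\<^sub>\<mu>\<close> in \<open>\<beta>\<^sub>1 \<and> \<beta>\<^sub>2 \<and> \<dots>\<close>; the determinant of any larger size is the same, as the
  series \<open>\<beta>\<^sub>i\<close> has leading term \<open>z\<^bsup>-i\<^esup>\<close>.\<close>

definition wedge_coeff :: "(nat \<Rightarrow> complex fls) \<Rightarrow> nat list \<Rightarrow> complex" where
  "wedge_coeff \<beta> \<mu> = det (mat (length \<mu>) (length \<mu>)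
     (\<lambda>(i, j). fls_nth (\<beta> (i + 1)) (int (\<mu> ! j) - int (j + 1))))"

definition KP_tau_function :: "mfps \<Rightarrow> bool" where
  "KP_tau_function T \<longleftrightarrow> (\<exists>\<beta> :: nat \<Rightarrow> complex fls.
     (\<forall>i\<ge>1. fls_nth (\<beta> i) (- int i) = 1 \<and> (\<forall>k < - int i. fls_nth (\<beta> i) k = 0)) \<and>
     T = formal_sum {\<mu>. is_partition \<mu>} (\<lambda>\<mu>. mfps_smult (wedge_coeff \<beta> \<mu>) (schur \<mu>)))"

definition KP_solution :: "mfps \<Rightarrow> bool" where
  "KP_solution F \<longleftrightarrow> (\<exists>T. KP_tau_function T \<and> F = mfps_ln T)"


section \<open>Graphs and the weighted chromatic polynomial\<close>

text \<open>A graph is a pair of a vertex set and a set of two-element edges.\<close>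

type_synonym 'a graph = "'a set \<times> 'a set set"

definition simple_graph :: "'a graph \<Rightarrow> bool" where
  "simple_graph G \<longleftrightarrow> finite (fst G) \<and> (\<forall>e\<in>snd G. e \<subseteq> fst G \<and> card e = 2)"

definition connected_graph :: "'a graph \<Rightarrow> bool" where
  "connected_graph G \<longleftrightarrow> fst G \<noteq> {} \<and>
     (\<forall>u\<in>fst G. \<forall>v\<in>fst G. (u, v) \<in> {(x, y). {x, y} \<in> snd G}\<^sup>*)"

definition graph_iso :: "'a graph \<Rightarrow> 'a graph \<Rightarrow> bool" where
  "graph_iso G H \<longleftrightarrow> (\<exists>f. bij_betw f (fst G) (fst H) \<and> (\<lambda>e. f ` e) ` snd G = snd H)"

definition Aut :: "'a graph \<Rightarrow> ('a \<Rightarrow> 'a) set" where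
  "Aut G = {\<pi>. \<pi> permutes fst G \<and> (\<lambda>e. \<pi> ` e) ` snd G = snd G}"

definition qvar :: "nat \<Rightarrow> mpoly" where
  "qvar n = Poly_Mapping.single (Poly_Mapping.single n 1) 1"

text \<open>Contracting the edge \<open>{u, v}\<close>: the vertex \<open>u\<close> plays the role of the new vertex, and multiple
  edges merge because the edges form a set.\<close>

definition contract_edges :: "'a \<Rightarrow> 'a \<Rightarrow> 'a set set \<Rightarrow> 'a set set" where
  "contract_edges u v E = (\<lambda>e. (\<lambda>x. if x = v then u else x) ` e) ` (E - {{u, v}})"

text \<open>\<open>wchrom V E w P\<close>: the polynomial \<open>P\<close> is a value obtained for the weighted graph
  \<open>(V, E, w)\<close> by applying the deletion-contraction rules to the edges in some order.  The
  weighted chromatic polynomial is the unique such value.\<close>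

inductive wchrom :: "'a set \<Rightarrow> 'a set set \<Rightarrow> ('a \<Rightarrow> nat) \<Rightarrow> mpoly \<Rightarrow> bool" where
  no_edges: "wchrom V {} w (\<Prod>v\<in>V. qvar (w v))"
| edge: "\<lbrakk>{u, v} \<in> E; u \<noteq> v;
          wchrom V (E - {{u, v}}) w P;
          wchrom (V - {v}) (contract_edges u v E) (w(u := w u + w v)) Q\<rbrakk>
         \<Longrightarrow> wchrom V E w (P + Q)"

definition weighted_chromatic_poly :: "'a graph \<Rightarrow> ('a \<Rightarrow> nat) \<Rightarrow> mpoly" where
  "weighted_chromatic_poly G w = (THE P. wchrom (fst G) (snd G) w P)"

text \<open>Every finite graph is isomorphic to one whose vertices are natural numbers, so these
  represent all isomorphism classes.\<close>

definition iso_rel :: "(nat graph \<times> nat graph) set" where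
  "iso_rel = {(G, H). simple_graph G \<and> simple_graph H \<and> graph_iso G H}"

definition graph_classes :: "nat graph set set" where
  "graph_classes = {G. simple_graph G} // iso_rel"

definition connected_graph_classes :: "nat graph set set" where
  "connected_graph_classes = {G. simple_graph G \<and> connected_graph G} // iso_rel"

definition graph_term :: "nat graph \<Rightarrow> mfps" where
  "graph_term G = mfps_smult (1 / of_nat (card (Aut G)))
     (mfps_of_mpoly (weighted_chromatic_poly G (\<lambda>_. 1)))"

text \<open>The term of an isomorphism class is that of an arbitrary representative.\<close>

definition W_connected :: mfps where
  "W_connected = formal_sum connected_graph_classes (\<lambda>C. graph_term (SOME G. G \<in> C))"

definition W_all :: mfps where
  "W_all = formal_sum graph_classes (\<lambda>C. graph_term (SOME G. G \<in> C))"

end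

theory Submission
  imports Defs
begin

text \<open>
  The substituted series \<open>\<W>\<^sup>\<circ>\<close> is \<open>\<Sum>\<^sub>n 2\<^bsup>n(n-1)/2\<^esup> s\<^sub>n\<close>, a combination of one-part Schur
  polynomials (\<open>rescaled_W_all\<close>).  Any series \<open>\<Sum> d\<^sub>n s\<^sub>n\<close> with \<open>d\<^sub>0 = 1\<close> is a tau function: take
  \<open>\<beta>\<^sub>1 = \<Sum> d\<^sub>n z\<^bsup>n-1\<^esup>\<close> and \<open>\<beta>\<^sub>i = z\<^bsup>-i\<^esup>\<close> for \<open>i \<ge> 2\<close>, so that only partitions with at most one part
  have nonzero coefficients (\<open>KP_tau_one_part_schur\<close>).

  To find the series, let \<open>V\<close> have \<open>n\<close> elements and use the subset expansion
  \<open>W\<^sub>G = (-1)\<^sup>n \<Sum>\<^bsub>F \<subseteq> E\<^esub> (-1)\<^bsup>|F|\<^esup> \<Prod>\<^sub>C (- q\<^bsub>|C|\<^esub>)\<close> over edge subsets, with \<open>C\<close> ranging over the components of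
  \<open>(V, F)\<close>; it follows from deletion and contraction (\<open>weighted_chromatic_poly_eq\<close>).  Summation over
  all graphs on \<open>V\<close> gives \<open>2\<^bsup>n(n-1)/2\<^esup> R\<^sub>n\<close>, where
  \<open>R\<^sub>n = (-1)\<^sup>n \<Sum>\<^sub>F (-1/2)\<^bsup>|F|\<^esup> \<Prod>\<^sub>C (- q\<^bsub>|C|\<^esub>)\<close> runs over all edge sets \<open>F\<close> on \<open>V\<close> (\<open>chrom_sum_eq\<close>).
  Splitting off the component of a fixed vertex yields
  \<open>R\<^sub>n = \<Sum>\<^sub>k (n-1 choose k-1) (-1)\<^bsup>k+1\<^esup> b\<^sub>k q\<^sub>k R\<^bsub>n-k\<^esub>\<close>, where \<open>b\<^sub>k\<close> is the sum of \<open>(-1/2)\<^bsup>|F|\<^esup>\<close> over the connected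
  graphs on \<open>k\<close> vertices.  The same splitting for the sum of \<open>(-1/2)\<^bsup>|F|\<^esup>\<close> over all graphs is the
  recursion for \<open>c\<^sub>n\<close>, so that \<open>b\<^sub>k = (-1)\<^bsup>k+1\<^esup> c\<^sub>k / 2\<^bsup>k(k-1)/2\<^esup>\<close> (\<open>sum_connected_graphs\<close>).  The substitution
  hence turns \<open>(-1)\<^bsup>k+1\<^esup> b\<^sub>k q\<^sub>k\<close> into \<open>(k-1)! p\<^sub>k\<close>, and \<open>R\<^sub>n\<close> satisfies the recursion of \<open>n! s\<^sub>n\<close>.

  A recursion of this binomial form is the differential equation of an exponential for the Euler
  derivation \<open>\<Sum> i q\<^sub>i \<partial>/\<partial>q\<^sub>i\<close> (\<open>exp_graded\<close>).  This is used for the Schur polynomials, and also for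
  \<open>exp \<W> = \<W>\<^sup>\<circ>\<close>, since \<open>W\<^sub>G\<close> is multiplicative over components.  The sums over isomorphism
  classes become sums over labelled graphs by the orbit-stabilizer theorem
  (\<open>sum_over_iso_classes\<close>).
\<close>

section \<open>Arithmetic of formal power series in countably many variables\<close>

lemma mfps_nth_simps [simp]:
  "mfps_nth 0 m = 0"
  "mfps_nth 1 m = (if m = 0 then 1 else 0)"
  "mfps_nth (F + G) m = mfps_nth F m + mfps_nth G m"
  "mfps_nth (F - G) m = mfps_nth F m - mfps_nth G m"
  "mfps_nth (- F) m = - mfps_nth F m"
  "mfps_nth (mfps_smult c F) m = c * mfps_nth F m"
  by (simp_all add: mfps_ring_defs mfps_smult_def)

lemma mfps_nth_mult:
  "mfps_nth (F * G) m = (\<Sum>(a, b)\<in>splits m. mfps_nth F a * mfps_nth G b)"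
  by (simp add: mfps_ring_defs)

lemma mfps_nth_sum: "mfps_nth (sum f A) m = (\<Sum>i\<in>A. mfps_nth (f i) m)"
  by (induction A rule: infinite_finite_induct) auto

lemma mfps_smult_mult: "mfps_smult c F * G = mfps_smult c (F * G)"
  by (rule mfps_eqI) (simp add: mfps_nth_mult case_prod_unfold sum_distrib_left mult.assoc)

lemma mult_mfps_smult: "F * mfps_smult c G = mfps_smult c (F * G)"
  using mfps_smult_mult[of c G F] by (simp add: mult.commute)

lemma of_nat_mfps_mult: "of_nat n * F = mfps_smult (of_nat n) F"
  by (induction n) (auto intro!: mfps_eqI simp: algebra_simps)

lemma mfps_smult_1 [simp]: "mfps_smult 1 F = F"
  by (rule mfps_eqI) simp

lemma mfps_smult_smult: "mfps_smult c (mfps_smult d F) = mfps_smult (c * d) F"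
  by (rule mfps_eqI) simp

lemma mfps_smult_sum: "mfps_smult c (sum f A) = (\<Sum>i\<in>A. mfps_smult c (f i))"
  by (rule mfps_eqI) (simp add: mfps_nth_sum sum_distrib_left)

lemma uminus_power_mfps: "(- F) ^ n = mfps_smult ((-1) ^ n) (F ^ n)"
proof (induction n)
  case (Suc n)
  have "(- F) ^ Suc n = - (F * (- F) ^ n)" by simp
  also have "\<dots> = mfps_smult ((-1) ^ Suc n) (F ^ Suc n)"
    unfolding Suc mult_mfps_smult by (rule mfps_eqI) simp
  finally show ?case .
qed simp

subsection \<open>Polynomials as power series\<close>

lemma mfps_of_mpoly_simps [simp]:
  "mfps_of_mpoly 0 = 0"
  "mfps_of_mpoly 1 = 1"
  "mfps_of_mpoly (P + Q) = mfps_of_mpoly P + mfps_of_mpoly Q"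
  "mfps_of_mpoly (- P) = - mfps_of_mpoly P"
  "mfps_of_mpoly (qvar n) = mfps_var n"
  by (auto intro!: mfps_eqI
      simp: mfps_of_mpoly_def lookup_add lookup_one qvar_def mfps_var_def lookup_single when_def)

lemma mfps_of_mpoly_mult [simp]: "mfps_of_mpoly (P * Q) = mfps_of_mpoly P * mfps_of_mpoly Q"
proof (rule mfps_eqI)
  fix m
  let ?f = "\<lambda>(a, b). Poly_Mapping.lookup P a * Poly_Mapping.lookup Q b when m = a + b"
  have "Poly_Mapping.lookup (P * Q) m = Sum_any ?f"
    unfolding times_poly_mapping.rep_eq
    by (rule prod_fun_unfold_prod) auto
  also have "\<dots> = sum ?f (splits m)"
    by (rule Sum_any.expand_superset[OF finite_splits]) (auto simp: splits_def when_def split: if_splits)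
  also have "\<dots> = mfps_nth (mfps_of_mpoly P * mfps_of_mpoly Q) m"
    unfolding mfps_nth_mult by (intro sum.cong) (auto simp: splits_def mfps_of_mpoly_def)
  finally show "mfps_nth (mfps_of_mpoly (P * Q)) m = mfps_nth (mfps_of_mpoly P * mfps_of_mpoly Q) m"
    by (simp add: mfps_of_mpoly_def)
qed

lemma mfps_of_mpoly_power: "mfps_of_mpoly (P ^ n) = mfps_of_mpoly P ^ n"
  by (induction n) auto

lemma mfps_of_mpoly_sum: "mfps_of_mpoly (sum f A) = (\<Sum>i\<in>A. mfps_of_mpoly (f i))"
  by (induction A rule: infinite_finite_induct) auto

lemma mfps_of_mpoly_prod: "mfps_of_mpoly (prod f A) = (\<Prod>i\<in>A. mfps_of_mpoly (f i))"
  by (induction A rule: infinite_finite_induct) auto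

subsection \<open>Weighted degree and rescaling of the variables\<close>

lemma wdeg_superset:
  assumes "finite A" "Poly_Mapping.keys m \<subseteq> A"
  shows "wdeg m = (\<Sum>i\<in>A. i * Poly_Mapping.lookup m i)"
  unfolding wdeg_def using assms
  by (intro sum.mono_neutral_left) (auto simp: in_keys_iff)

lemma wdeg_0 [simp]: "wdeg 0 = 0"
  by (simp add: wdeg_def)

lemma wdeg_single [simp]: "wdeg (Poly_Mapping.single i k) = i * k"
  by (simp add: wdeg_def)

lemma wdeg_add: "wdeg (a + b) = wdeg a + wdeg b"
proof -
  let ?A = "Poly_Mapping.keys a \<union> Poly_Mapping.keys b"
  have "wdeg (a + b) = (\<Sum>i\<in>?A. i * Poly_Mapping.lookup (a + b) i)"
    by (rule wdeg_superset) (use keys_add[of a b] in auto)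
  then show ?thesis
    by (simp add: lookup_add ring_distribs sum.distrib wdeg_superset[of ?A])
qed

lemma wdeg_splits: "(a, b) \<in> splits m \<Longrightarrow> wdeg m = wdeg a + wdeg b"
  by (auto simp: splits_def wdeg_add)

text \<open>The factor that the substitution \<open>q\<^sub>i = a\<^sub>i p\<^sub>i\<close> contributes to a monomial.\<close>

definition scale_factor :: "(nat \<Rightarrow> complex) \<Rightarrow> monom \<Rightarrow> complex" where
  "scale_factor a m = (\<Prod>i\<in>Poly_Mapping.keys m. a i ^ Poly_Mapping.lookup m i)"

lemma scale_factor_superset:
  assumes "finite A" "Poly_Mapping.keys m \<subseteq> A"
  shows "scale_factor a m = (\<Prod>i\<in>A. a i ^ Poly_Mapping.lookup m i)"
  unfolding scale_factor_def using assms
  by (intro prod.mono_neutral_left) (auto simp: in_keys_iff)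

lemma scale_factor_add: "scale_factor a (x + y) = scale_factor a x * scale_factor a y"
proof -
  let ?A = "Poly_Mapping.keys x \<union> Poly_Mapping.keys y"
  have "scale_factor a (x + y) = (\<Prod>i\<in>?A. a i ^ Poly_Mapping.lookup (x + y) i)"
    by (rule scale_factor_superset) (use keys_add[of x y] in auto)
  then show ?thesis
    by (simp add: lookup_add power_add prod.distrib scale_factor_superset[of ?A])
qed

lemma mfps_nth_rescale_vars: "mfps_nth (rescale_vars a F) m = scale_factor a m * mfps_nth F m"
  by (simp add: rescale_vars_def scale_factor_def)

lemma rescale_vars_simps [simp]:
  "rescale_vars a 0 = 0"
  "rescale_vars a 1 = 1"
  "rescale_vars a (F + G) = rescale_vars a F + rescale_vars a G"
  "rescale_vars a (- F) = - rescale_vars a F"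
  "rescale_vars a (mfps_smult c F) = mfps_smult c (rescale_vars a F)"
  by (auto intro!: mfps_eqI simp: mfps_nth_rescale_vars scale_factor_def algebra_simps)

lemma rescale_vars_var: "rescale_vars a (mfps_var n) = mfps_smult (a n) (mfps_var n)"
  by (rule mfps_eqI) (simp add: mfps_nth_rescale_vars mfps_var_def scale_factor_def)

lemma rescale_vars_mult [simp]: "rescale_vars a (F * G) = rescale_vars a F * rescale_vars a G"
proof (rule mfps_eqI)
  fix m
  show "mfps_nth (rescale_vars a (F * G)) m = mfps_nth (rescale_vars a F * rescale_vars a G) m"
    unfolding mfps_nth_mult mfps_nth_rescale_vars sum_distrib_left
    by (intro sum.cong) (auto simp: splits_def scale_factor_add)
qed

lemma rescale_vars_power: "rescale_vars a (F ^ n) = rescale_vars a F ^ n"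
  by (induction n) auto

lemma rescale_vars_sum: "rescale_vars a (sum f A) = (\<Sum>i\<in>A. rescale_vars a (f i))"
  by (induction A rule: infinite_finite_induct) auto

subsection \<open>Homogeneous series and series of positive order\<close>

text \<open>The zero series is homogeneous of every degree.\<close>

definition homogeneous :: "nat \<Rightarrow> mfps \<Rightarrow> bool" where
  "homogeneous n F \<longleftrightarrow> (\<forall>m. mfps_nth F m \<noteq> 0 \<longrightarrow> wdeg m = n)"

lemma homogeneous_1: "homogeneous 0 1"
  by (simp add: homogeneous_def)

lemma homogeneous_0: "homogeneous n 0"
  by (simp add: homogeneous_def)

lemma homogeneous_var: "homogeneous n (mfps_var n)"
  by (auto simp: homogeneous_def mfps_var_def)

lemma homogeneous_smult: "homogeneous n F \<Longrightarrow> homogeneous n (mfps_smult c F)"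
  by (simp add: homogeneous_def)

lemma homogeneous_uminus: "homogeneous n F \<Longrightarrow> homogeneous n (- F)"
  by (simp add: homogeneous_def)

lemma homogeneous_mult:
  assumes "homogeneous k F" "homogeneous l G" shows "homogeneous (k + l) (F * G)"
  unfolding homogeneous_def
proof (intro allI impI)
  fix m assume "mfps_nth (F * G) m \<noteq> 0"
  then obtain a b where "(a, b) \<in> splits m" "mfps_nth F a * mfps_nth G b \<noteq> 0"
    unfolding mfps_nth_mult by (auto elim!: sum.not_neutral_contains_not_neutral)
  with assms show "wdeg m = k + l"
    by (auto simp: homogeneous_def dest!: wdeg_splits)
qed

lemma homogeneous_0_power: "homogeneous 0 y \<Longrightarrow> homogeneous 0 (y ^ n)"
  using homogeneous_mult[of 0 y 0] by (induction n) (auto intro: homogeneous_1)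

lemma homogeneous_sum: "(\<And>i. i \<in> A \<Longrightarrow> homogeneous n (f i)) \<Longrightarrow> homogeneous n (sum f A)"
  unfolding homogeneous_def mfps_nth_sum by (meson sum.neutral)

lemma homogeneous_prod:
  "finite A \<Longrightarrow> (\<And>i. i \<in> A \<Longrightarrow> homogeneous (d i) (f i)) \<Longrightarrow> homogeneous (sum d A) (prod f A)"
  by (induction A rule: finite_induct) (auto intro: homogeneous_1 homogeneous_mult)

text \<open>The series all of whose terms have weighted degree at least \<open>n\<close>.  With \<open>n = 1\<close>, these are
  the series to which the exponential is applied.\<close>

definition order_ge :: "nat \<Rightarrow> mfps \<Rightarrow> bool" where
  "order_ge n F \<longleftrightarrow> (\<forall>m. wdeg m < n \<longrightarrow> mfps_nth F m = 0)"

lemma order_ge_mult: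
  assumes "order_ge k F" "order_ge l G" shows "order_ge (k + l) (F * G)"
  unfolding order_ge_def
proof (intro allI impI)
  fix m assume m: "wdeg m < k + l"
  show "mfps_nth (F * G) m = 0"
    unfolding mfps_nth_mult
  proof (rule sum.neutral, safe)
    fix a b assume "(a, b) \<in> splits m"
    then have "wdeg a < k \<or> wdeg b < l"
      using m by (auto dest!: wdeg_splits)
    then show "mfps_nth F a * mfps_nth G b = 0"
      using assms by (auto simp: order_ge_def)
  qed
qed

lemma order_ge_0 [simp]: "order_ge 0 F"
  by (simp add: order_ge_def)

lemma order_ge_power: "order_ge 1 F \<Longrightarrow> order_ge n (F ^ n)"
  using order_ge_mult[of 1 F] by (induction n) auto

lemma order_ge_mult_power: "order_ge 1 F \<Longrightarrow> order_ge n (F ^ n * G)"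
  using order_ge_mult[OF order_ge_power[of F n], of 0 G] by simp

text \<open>The series whose part of degree \<open>n\<close> is that of \<open>P n\<close>.\<close>

definition graded_series :: "(nat \<Rightarrow> mfps) \<Rightarrow> mfps" where
  "graded_series P = Abs_mfps (\<lambda>m. mfps_nth (P (wdeg m)) m)"

lemma mfps_nth_graded [simp]: "mfps_nth (graded_series P) m = mfps_nth (P (wdeg m)) m"
  by (simp add: graded_series_def)

lemma mfps_nth_graded_mult:
  assumes P: "\<And>k. homogeneous k (P k)" and Q: "\<And>k. homogeneous k (Q k)"
  shows "mfps_nth (graded_series P * graded_series Q) m =
           (\<Sum>k\<le>wdeg m. mfps_nth (P k * Q (wdeg m - k)) m)"
proof -
  have "(\<Sum>k\<le>wdeg m. mfps_nth (P k * Q (wdeg m - k)) m) =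
      (\<Sum>(a, b)\<in>splits m. \<Sum>k\<le>wdeg m. mfps_nth (P k) a * mfps_nth (Q (wdeg m - k)) b)"
    unfolding mfps_nth_mult case_prod_unfold by (rule sum.swap)
  also have "\<dots> = (\<Sum>(a, b)\<in>splits m. mfps_nth (P (wdeg a)) a * mfps_nth (Q (wdeg b)) b)"
  proof (intro sum.cong refl, safe)
    fix a b assume ab: "(a, b) \<in> splits m"
    have "(\<Sum>k\<le>wdeg m. mfps_nth (P k) a * mfps_nth (Q (wdeg m - k)) b)
        = (\<Sum>k\<in>{wdeg a}. mfps_nth (P k) a * mfps_nth (Q (wdeg m - k)) b)"
      using wdeg_splits[OF ab] P[unfolded homogeneous_def]
      by (intro sum.mono_neutral_right) auto
    then show "(\<Sum>k\<le>wdeg m. mfps_nth (P k) a * mfps_nth (Q (wdeg m - k)) b)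
        = mfps_nth (P (wdeg a)) a * mfps_nth (Q (wdeg b)) b"
      using wdeg_splits[OF ab] by simp
  qed
  finally show ?thesis by (simp add: mfps_nth_mult)
qed

section \<open>Exponential and logarithm via the Euler derivation\<close>

text \<open>The Euler derivation \<open>\<Sum> i q\<^sub>i \<partial>/\<partial>q\<^sub>i\<close>, which multiplies the part of weighted degree \<open>n\<close> by \<open>n\<close>.\<close>

definition euler :: "mfps \<Rightarrow> mfps" where
  "euler F = Abs_mfps (\<lambda>m. of_nat (wdeg m) * mfps_nth F m)"

lemma mfps_nth_euler [simp]: "mfps_nth (euler F) m = of_nat (wdeg m) * mfps_nth F m"
  by (simp add: euler_def)

lemma euler_mult: "euler (F * G) = euler F * G + F * euler G"
proof (rule mfps_eqI)
  fix m
  show "mfps_nth (euler (F * G)) m = mfps_nth (euler F * G + F * euler G) m"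
    unfolding mfps_nth_euler mfps_nth_simps mfps_nth_mult sum_distrib_left sum.distrib[symmetric]
    by (intro sum.cong) (auto dest!: wdeg_splits simp: algebra_simps)
qed

lemma euler_1 [simp]: "euler 1 = 0"
  by (rule mfps_eqI) simp

lemma euler_add: "euler (F + G) = euler F + euler G"
  by (rule mfps_eqI) (simp add: algebra_simps)

lemma euler_diff: "euler (F - G) = euler F - euler G"
  by (rule mfps_eqI) (simp add: algebra_simps)

lemma euler_smult: "euler (mfps_smult c F) = mfps_smult c (euler F)"
  by (rule mfps_eqI) simp

lemma euler_sum: "euler (sum f A) = (\<Sum>i\<in>A. euler (f i))"
  by (rule mfps_eqI) (simp add: mfps_nth_sum sum_distrib_left)

lemma euler_power_Suc: "euler (F ^ Suc n) = mfps_smult (of_nat (Suc n)) (F ^ n * euler F)"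
proof (induction n)
  case (Suc n)
  have "euler (F ^ Suc (Suc n)) = euler F * F ^ Suc n + F * euler (F ^ Suc n)"
    by (simp only: power_Suc[of F "Suc n"] euler_mult)
  also have "\<dots> = of_nat (Suc (Suc n)) * (F ^ Suc n * euler F)"
    unfolding Suc of_nat_mfps_mult[symmetric] by (simp add: algebra_simps)
  finally show ?case by (simp only: of_nat_mfps_mult)
qed simp

text \<open>A solution of the linear differential equation \<open>euler T = A T\<close> is determined by its part
  of degree \<open>0\<close>.\<close>

lemma euler_equation_unique:
  assumes A: "order_ge 1 A"
    and "euler T = A * T" "euler U = A * U"
    and TU: "\<And>m. wdeg m = 0 \<Longrightarrow> mfps_nth T m = mfps_nth U m"
  shows "T = U"
proof -
  define V where "V = T - U"
  have V: "euler V = A * V"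
    using assms by (simp add: V_def euler_diff algebra_simps)
  have "mfps_nth V m = 0" for m
  proof (induction "wdeg m" arbitrary: m rule: less_induct)
    case less
    show ?case
    proof (cases "wdeg m = 0")
      case True
      then show ?thesis using TU by (simp add: V_def)
    next
      case False
      have "mfps_nth A a * mfps_nth V b = 0" if "(a, b) \<in> splits m" for a b
        using wdeg_splits[OF that] less A by (cases "wdeg a = 0") (auto simp: order_ge_def)
      then have "mfps_nth (A * V) m = 0"
        unfolding mfps_nth_mult by (auto intro!: sum.neutral)
      then show ?thesis
        using False V by (metis mfps_nth_euler mult_eq_0_iff of_nat_eq_0_iff)
    qed
  qed
  then show ?thesis by (auto intro!: mfps_eqI simp: V_def)
qed

lemma mfps_nth_formal_sum_finite:
  assumes "finite B" "B \<subseteq> A" "\<And>i. i \<in> A - B \<Longrightarrow> mfps_nth (f i) m = 0"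
  shows "mfps_nth (formal_sum A f) m = (\<Sum>i\<in>B. mfps_nth (f i) m)"
  unfolding formal_sum_def mfps_nth_Abs
  using assms by (intro sum.mono_neutral_left) auto

text \<open>In a given degree, the exponential and the logarithm are finite sums.  The number of terms may be
  taken larger than the degree, which leaves room for the shift of the index in a derivative.\<close>

lemma mfps_nth_exp:
  assumes "order_ge 1 F" "wdeg m \<le> N"
  shows "mfps_nth (mfps_exp F) m = mfps_nth (\<Sum>n\<le>N. mfps_smult (1 / fact n) (F ^ n)) m"
  unfolding mfps_exp_def mfps_nth_sum
  using assms order_ge_power[OF assms(1)]
  by (intro mfps_nth_formal_sum_finite) (auto simp: order_ge_def)

lemma mfps_nth_ln:
  assumes "order_ge 1 (T - 1)" "wdeg m \<le> N"
  shows "mfps_nth (mfps_ln T) m =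
    mfps_nth (\<Sum>n=1..N. mfps_smult ((-1) ^ (n + 1) / of_nat n) ((T - 1) ^ n)) m"
  unfolding mfps_ln_def mfps_nth_sum
  using assms order_ge_power[OF assms(1)]
  by (intro mfps_nth_formal_sum_finite) (auto simp: order_ge_def)

lemma mfps_nth_mult_cong:
  assumes "\<And>a. wdeg a \<le> wdeg m \<Longrightarrow> mfps_nth F a = mfps_nth F' a"
  shows "mfps_nth (F * G) m = mfps_nth (F' * G) m"
  unfolding mfps_nth_mult by (intro sum.cong) (auto simp: assms dest!: wdeg_splits)

lemma mfps_nth_exp_degree_0:
  assumes "order_ge 1 F" "wdeg m = 0"
  shows "mfps_nth (mfps_exp F) m = (if m = 0 then 1 else 0)"
  using mfps_nth_exp[OF assms(1), of m 0] assms(2) by simp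

lemma euler_exp:
  assumes F: "order_ge 1 F"
  shows "euler (mfps_exp F) = euler F * mfps_exp F"
proof (rule mfps_eqI)
  fix m
  let ?N = "wdeg m"
  let ?e = "\<lambda>N. \<Sum>n\<le>N. mfps_smult (1 / fact n) (F ^ n)"
  have "mfps_nth (euler (mfps_exp F)) m = mfps_nth (euler (?e (Suc ?N))) m"
    using mfps_nth_exp[OF F, of m "Suc ?N"] by simp
  also have "euler (?e (Suc ?N)) =
      (\<Sum>n\<le>?N. mfps_smult (1 / fact (Suc n)) (euler (F ^ Suc n)))"
    unfolding sum.atMost_Suc_shift euler_add euler_sum euler_smult power_0 euler_1
    by (rule mfps_eqI) simp
  also have "\<dots> = ?e ?N * euler F"
    unfolding sum_distrib_right euler_power_Suc mfps_smult_smult mfps_smult_mult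
    by (simp del: of_nat_Suc)
  also have "mfps_nth (?e ?N * euler F) m = mfps_nth (mfps_exp F * euler F) m"
    by (rule mfps_nth_mult_cong) (rule mfps_nth_exp[OF F, symmetric])
  finally show "mfps_nth (euler (mfps_exp F)) m = mfps_nth (euler F * mfps_exp F) m"
    by (simp add: mult.commute)
qed

text \<open>With \<open>U = T - 1\<close>, the derivative of the logarithm is \<open>(1 - U + U\<^sup>2 - \<dots>) euler T\<close>, and the product
  with \<open>T = 1 + U\<close> telescopes.\<close>

lemma euler_ln:
  assumes T: "order_ge 1 (T - 1)"
  shows "euler (mfps_ln T) * T = euler T"
proof (rule mfps_eqI)
  fix m
  let ?N = "wdeg m" and ?U = "T - 1"
  let ?l = "\<Sum>n=1..Suc ?N. mfps_smult ((-1) ^ (n + 1) / of_nat n) (?U ^ n)"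
  have "mfps_smult ((-1) ^ (n + 1) / of_nat n) (euler (?U ^ n)) = (- ?U) ^ (n - 1) * euler T"
    if "n \<in> {1..Suc ?N}" for n
  proof -
    obtain k where k: "n = Suc k" using \<open>n \<in> _\<close> by (cases n) auto
    show ?thesis
      unfolding k euler_power_Suc mfps_smult_smult uminus_power_mfps
      by (simp add: mfps_smult_mult euler_diff del: of_nat_Suc)
  qed
  then have "euler ?l = (\<Sum>n=1..Suc ?N. (- ?U) ^ (n - 1) * euler T)"
    unfolding euler_sum euler_smult by (intro sum.cong) auto
  also have "\<dots> = (\<Sum>n<Suc ?N. (- ?U) ^ n) * euler T"
    unfolding sum_distrib_right
    by (rule sum.reindex_bij_witness[of _ Suc "\<lambda>n. n - 1"]) auto
  finally have l: "euler ?l * T = (\<Sum>n<Suc ?N. (- ?U) ^ n) * (1 - (- ?U)) * euler T"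
    by (simp add: algebra_simps del: sum.lessThan_Suc)
  also have "(\<Sum>n<Suc ?N. (- ?U) ^ n) * (1 - (- ?U)) = 1 - (- ?U) ^ Suc ?N"
    by (simp only: one_diff_power_eq mult.commute)
  finally have *: "euler ?l * T = euler T - (- ?U) ^ Suc ?N * euler T"
    by (simp add: algebra_simps)
  have "mfps_nth (euler (mfps_ln T) * T) m = mfps_nth (euler ?l * T) m"
    by (rule mfps_nth_mult_cong)
       (simp only: mfps_nth_euler mfps_nth_ln[OF T le_SucI])
  also have "order_ge 1 (- ?U)"
    using T by (simp add: order_ge_def)
  then have "order_ge (Suc ?N) ((- ?U) ^ Suc ?N * euler T)"
    by (rule order_ge_mult_power)
  then have "mfps_nth (euler ?l * T) m = mfps_nth (euler T) m"
    unfolding * by (simp add: order_ge_def)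
  finally show "mfps_nth (euler (mfps_ln T) * T) m = mfps_nth (euler T) m" .
qed

text \<open>With \<open>U = 1 - T\<close>, the hypothesis says \<open>G = U G\<close>, hence \<open>G = U\<^sup>n G\<close> has arbitrarily high order.\<close>

lemma mult_unit_cancel:
  assumes T: "order_ge 1 (T - 1)" and G: "G * T = 0"
  shows "G = 0"
proof (rule mfps_eqI)
  fix m
  have G: "- (T - 1) * G = G"
    using G by (simp add: algebra_simps)
  have "G = (- (T - 1)) ^ n * G" for n
  proof (induction n)
    case (Suc n)
    have "(- (T - 1)) ^ Suc n * G = (- (T - 1)) ^ n * G"
      unfolding power_Suc2 mult.assoc G ..
    then show ?case using Suc by simp
  qed simp
  moreover have "order_ge 1 (- (T - 1))"
    using T by (simp add: order_ge_def)
  ultimately have "order_ge (Suc (wdeg m)) G"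
    by (metis order_ge_mult_power)
  then show "mfps_nth G m = mfps_nth 0 m"
    by (simp add: order_ge_def)
qed

text \<open>Both sides have the same logarithmic derivative \<open>euler T / T\<close>, where \<open>T = exp F\<close>.\<close>

lemma mfps_ln_exp:
  assumes F: "order_ge 1 F" shows "mfps_ln (mfps_exp F) = F"
proof -
  let ?T = "mfps_exp F"
  have T: "order_ge 1 (?T - 1)"
    using mfps_nth_exp_degree_0[OF F] by (auto simp: order_ge_def)
  have "(euler (mfps_ln ?T) - euler F) * ?T = 0"
    using euler_ln[OF T] euler_exp[OF F] by (simp add: algebra_simps)
  then have "euler (mfps_ln ?T) = euler F"
    using mult_unit_cancel[OF T] by fastforce
  then have eq: "of_nat (wdeg m) * mfps_nth (mfps_ln ?T) m = of_nat (wdeg m) * mfps_nth F m" for m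
    by (metis mfps_nth_euler)
  show ?thesis
  proof (rule mfps_eqI)
    fix m
    show "mfps_nth (mfps_ln ?T) m = mfps_nth F m"
      using eq[of m] mfps_nth_ln[OF T, of m 0] F
      by (cases "wdeg m = 0") (auto simp: order_ge_def)
  qed
qed

lemma rescale_vars_exp:
  assumes F: "order_ge 1 F"
  shows "rescale_vars a (mfps_exp F) = mfps_exp (rescale_vars a F)"
proof (rule mfps_eqI)
  fix m
  have "order_ge 1 (rescale_vars a F)"
    using F by (simp add: order_ge_def mfps_nth_rescale_vars)
  then have "mfps_nth (mfps_exp (rescale_vars a F)) m =
      mfps_nth (rescale_vars a (\<Sum>n\<le>wdeg m. mfps_smult (1 / fact n) (F ^ n))) m"
    by (simp add: mfps_nth_exp[of _ m "wdeg m"] rescale_vars_sum rescale_vars_power)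
  also have "\<dots> = mfps_nth (rescale_vars a (mfps_exp F)) m"
    using mfps_nth_exp[OF F, of m "wdeg m"] by (simp only: mfps_nth_rescale_vars)
  finally show "mfps_nth (rescale_vars a (mfps_exp F)) m = mfps_nth (mfps_exp (rescale_vars a F)) m"
    by simp
qed

section \<open>Connected components of a graph\<close>

text \<open>Adjacency.  A singleton \<open>{x}\<close> in \<open>E\<close> would make \<open>x\<close> adjacent to itself, which does not affect
  reachability.\<close>

definition adj :: "'a set set \<Rightarrow> ('a \<times> 'a) set" where
  "adj E = {(x, y). {x, y} \<in> E}"

text \<open>The set of vertices that can be reached from \<open>x\<close>.\<close>

definition component :: "'a set set \<Rightarrow> 'a \<Rightarrow> 'a set" where
  "component E x = {y. (x, y) \<in> (adj E)\<^sup>*}"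

text \<open>The vertex sets of the connected components of the graph \<open>(V, E)\<close>; an isolated vertex forms a component.\<close>

definition components :: "'a set \<Rightarrow> 'a set set \<Rightarrow> 'a set set" where
  "components V E = component E ` V"

text \<open>The edges of the complete graph with vertex set \<open>V\<close>.  Graphs on \<open>V\<close> are the subsets of this set.\<close>

definition edges_on :: "'a set \<Rightarrow> 'a set set" where
  "edges_on V = {e. e \<subseteq> V \<and> card e = 2}"

lemma simple_graph_iff: "simple_graph (V, E) \<longleftrightarrow> finite V \<and> E \<subseteq> edges_on V"
  by (auto simp: simple_graph_def edges_on_def)

lemma finite_edges_on [simp]: "finite V \<Longrightarrow> finite (edges_on V)"
  unfolding edges_on_def by (rule finite_subset[of _ "Pow V"]) auto

lemma card_edges_on: "finite V \<Longrightarrow> card (edges_on V) = card V choose 2"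
  unfolding edges_on_def by (rule n_subsets)

lemma edges_on_subset_Pow: "edges_on V \<subseteq> Pow V"
  by (auto simp: edges_on_def)

lemma edges_on_mono: "S \<subseteq> V \<Longrightarrow> edges_on S \<subseteq> edges_on V"
  by (auto simp: edges_on_def)

lemma edges_on_nonempty: "e \<in> edges_on V \<Longrightarrow> e \<noteq> {}"
  by (auto simp: edges_on_def)

lemma edges_on_disjoint:
  assumes "S \<inter> T = {}" shows "edges_on S \<inter> edges_on T = {}"
proof -
  have False if "e \<in> edges_on S" "e \<in> edges_on T" for e
    using that assms edges_on_nonempty[of e S] by (simp add: edges_on_def) blast
  then show ?thesis by blast
qed

lemma finite_subset_edges_on: "finite V \<Longrightarrow> E \<subseteq> edges_on V \<Longrightarrow> finite E"
  by (rule finite_subset[OF _ finite_edges_on])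

lemma edges_onE:
  assumes "e \<in> edges_on V"
  obtains x y where "e = {x, y}" "x \<noteq> y" "x \<in> V" "y \<in> V"
  using assms by (auto simp: edges_on_def card_2_iff)

lemma adj_sym: "(x, y) \<in> (adj E)\<^sup>* \<Longrightarrow> (y, x) \<in> (adj E)\<^sup>*"
proof -
  have "sym (adj E)" by (auto simp: sym_def adj_def insert_commute)
  then show "(x, y) \<in> (adj E)\<^sup>* \<Longrightarrow> (y, x) \<in> (adj E)\<^sup>*"
    using sym_rtrancl symD by metis
qed

lemma component_refl [simp]: "x \<in> component E x"
  by (simp add: component_def)

lemma component_eq: "y \<in> component E x \<Longrightarrow> component E y = component E x"
  unfolding component_def by (auto intro: rtrancl_trans adj_sym)

lemma component_subset:
  assumes "E \<subseteq> Pow V" "x \<in> V" shows "component E x \<subseteq> V"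
proof
  fix y assume "y \<in> component E x"
  then have "(x, y) \<in> (adj E)\<^sup>*" by (simp add: component_def)
  then show "y \<in> V"
    by (induction rule: rtrancl_induct) (use assms in \<open>auto simp: adj_def\<close>)
qed

lemma components_subset: "E \<subseteq> Pow V \<Longrightarrow> C \<in> components V E \<Longrightarrow> C \<subseteq> V \<and> C \<noteq> {}"
  using component_subset[of E V] component_refl[of _ E] unfolding components_def by blast

lemma Union_components: "E \<subseteq> Pow V \<Longrightarrow> \<Union>(components V E) = V"
  using component_subset[of E V] component_refl[of _ E] unfolding components_def by blast

lemma disjoint_components:
  assumes "C \<in> components V E" "D \<in> components V E" "C \<noteq> D" shows "C \<inter> D = {}"
proof -
  obtain x y where xy: "C = component E x" "D = component E y"
    using assms by (auto simp: components_def)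
  show ?thesis
  proof (rule ccontr)
    assume "C \<inter> D \<noteq> {}"
    then obtain z where "z \<in> C" "z \<in> D" by blast
    then show False using component_eq[of z E x] component_eq[of z E y] xy assms(3) by simp
  qed
qed

lemma connected_graph_iff:
  assumes "E \<subseteq> Pow V"
  shows "connected_graph (V, E) \<longleftrightarrow> V \<noteq> {} \<and> (\<forall>x\<in>V. component E x = V)"
proof -
  have "connected_graph (V, E) \<longleftrightarrow> V \<noteq> {} \<and> (\<forall>x\<in>V. V \<subseteq> component E x)"
    by (auto simp: connected_graph_def component_def adj_def)
  then show ?thesis using component_subset[OF assms] by blast
qed

lemma components_connected:
  assumes "E \<subseteq> Pow V" "connected_graph (V, E)" shows "components V E = {V}"
  using assms connected_graph_iff[of E V] by (auto simp: components_def)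

lemma component_disjoint_Un:
  assumes "S \<inter> T = {}" "E1 \<subseteq> Pow S" "E2 \<subseteq> Pow T" "x \<in> S"
  shows "component (E1 \<union> E2) x = component E1 x"
proof -
  have "y \<in> S \<and> (x, y) \<in> (adj E1)\<^sup>*" if "(x, y) \<in> (adj (E1 \<union> E2))\<^sup>*" for y
    using that
  proof (induction rule: rtrancl_induct)
    case (step y z)
    then have "{y, z} \<in> E1 \<union> E2" "y \<in> S" by (auto simp: adj_def)
    then have "{y, z} \<in> E1" using assms by blast
    then have "z \<in> S" "(y, z) \<in> adj E1" using assms by (auto simp: adj_def)
    then show ?case using step by (blast intro: rtrancl_into_rtrancl)
  qed (use assms in auto)
  moreover have "(adj E1)\<^sup>* \<subseteq> (adj (E1 \<union> E2))\<^sup>*"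
    by (rule rtrancl_mono) (auto simp: adj_def)
  ultimately show ?thesis
    unfolding component_def by blast
qed

lemma components_disjoint_Un:
  assumes "S \<inter> T = {}" "E1 \<subseteq> Pow S" "E2 \<subseteq> Pow T"
  shows "components (S \<union> T) (E1 \<union> E2) = components S E1 \<union> components T E2"
proof -
  have "component (E1 \<union> E2) ` S = component E1 ` S"
    using component_disjoint_Un[OF assms] by (rule image_cong[OF refl])
  moreover have "component (E1 \<union> E2) ` T = component E2 ` T"
    using component_disjoint_Un[of T S E2 E1] assms
    by (intro image_cong) (auto simp: Un_commute)
  ultimately show ?thesis by (simp add: components_def image_Un)
qed

lemma component_image:
  assumes f: "inj_on f V" and E: "E \<subseteq> Pow V" and x: "x \<in> V"
  shows "component ((`) f ` E) (f x) = f ` component E x"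
proof (intro equalityI subsetI)
  fix z assume "z \<in> component ((`) f ` E) (f x)"
  then have "(f x, z) \<in> (adj ((`) f ` E))\<^sup>*" by (simp add: component_def)
  then have "\<exists>y\<in>V. z = f y \<and> (x, y) \<in> (adj E)\<^sup>*"
  proof (induction rule: rtrancl_induct)
    case base
    then show ?case using x by auto
  next
    case (step z z')
    then obtain y where y: "y \<in> V" "z = f y" "(x, y) \<in> (adj E)\<^sup>*" by auto
    obtain e where e: "e \<in> E" "{z, z'} = f ` e" using step by (auto simp: adj_def)
    obtain b where b: "b \<in> e" "z' = f b" using e by blast
    have "f ` {y, b} = f ` e" using e b y by simp
    then have "{y, b} = e"
      using inj_on_image_eq_iff[OF f, of "{y, b}" e] e b y E by auto
    then have "(y, b) \<in> adj E" using e by (simp add: adj_def)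
    then have "(x, b) \<in> (adj E)\<^sup>*" using y(3) by (rule rtrancl_into_rtrancl[rotated])
    then show ?case using b e E by blast
  qed
  then show "z \<in> f ` component E x" by (auto simp: component_def)
next
  fix z assume "z \<in> f ` component E x"
  then obtain y where y: "z = f y" "(x, y) \<in> (adj E)\<^sup>*" by (auto simp: component_def)
  from y(2) have "(f x, f y) \<in> (adj ((`) f ` E))\<^sup>*"
  proof (induction rule: rtrancl_induct)
    case (step y z)
    then have "f ` {y, z} \<in> (`) f ` E" unfolding adj_def by blast
    then have "(f y, f z) \<in> adj ((`) f ` E)" by (simp add: adj_def)
    then show ?case using step by (blast intro: rtrancl_into_rtrancl)
  qed simp
  then show "z \<in> component ((`) f ` E) (f x)" using y by (simp add: component_def)
qed

lemma components_image:
  assumes "inj_on f V" "E \<subseteq> Pow V"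
  shows "components (f ` V) ((`) f ` E) = (`) f ` components V E"
  using component_image[OF assms] by (auto simp: components_def image_image)

lemma connected_graph_image:
  assumes "inj_on f V" "E \<subseteq> Pow V" "connected_graph (V, E)"
  shows "connected_graph (f ` V, (`) f ` E)"
proof -
  have "(`) f ` E \<subseteq> Pow (f ` V)" using assms by auto
  then show ?thesis
    using assms component_image[OF assms(1,2)]
    by (auto simp: connected_graph_iff)
qed

text \<open>Contracting the edge \<open>{u, v}\<close> does not change the components of a graph that contains this
  edge, except that \<open>v\<close> is removed.\<close>

lemma component_contract:
  assumes F: "F \<subseteq> edges_on V" and V: "u \<in> V" "v \<in> V" "u \<noteq> v" "x \<in> V"
  defines "\<phi> \<equiv> \<lambda>x. if x = v then u else x"
  shows "component ((`) \<phi> ` F) (\<phi> x) = component (insert {u, v} F) x - {v}"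
proof -
  let ?A = "adj (insert {u, v} F)" and ?B = "adj ((`) \<phi> ` F)"
  \<comment> \<open>In the graph with the edge \<open>{u, v}\<close>, every vertex is connected to its image under contraction.\<close>
  have to_phi: "(x, \<phi> x) \<in> ?A\<^sup>*" for x
    by (auto simp: \<phi>_def adj_def insert_commute)
  have A: "(\<phi> x, \<phi> y) \<in> ?B\<^sup>*" if "(x, y) \<in> ?A\<^sup>*" for x y
    using that
  proof (induction rule: rtrancl_induct)
    case (step y z)
    then consider "{y, z} = {u, v}" | "{y, z} \<in> F" by (auto simp: adj_def)
    then have "\<phi> y = \<phi> z \<or> (\<phi> y, \<phi> z) \<in> ?B"
    proof cases
      case 2
      then have "\<phi> ` {y, z} \<in> (`) \<phi> ` F" by (rule imageI)
      then show ?thesis by (simp add: adj_def)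
    qed (auto simp: \<phi>_def doubleton_eq_iff)
    then show ?case using step(3) by (auto intro: rtrancl_into_rtrancl)
  qed simp
  have "(a, b) \<in> ?A\<^sup>*" if "(a, b) \<in> ?B" for a b
  proof -
    have "{a, b} \<in> (`) \<phi> ` F" using that by (simp add: adj_def)
    then obtain c d where cd: "{c, d} \<in> F" "{a, b} = {\<phi> c, \<phi> d}"
      using F by (auto simp: edges_on_def card_2_iff)
    have "(c, d) \<in> ?A\<^sup>*" using cd by (auto simp: adj_def)
    then have "(\<phi> c, \<phi> d) \<in> ?A\<^sup>*"
      by (rule rtrancl_trans[OF adj_sym[OF to_phi] rtrancl_trans[OF _ to_phi]])
    then show ?thesis using cd(2) adj_sym by (auto simp: doubleton_eq_iff)
  qed
  then have "?B\<^sup>* \<subseteq> ?A\<^sup>*"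
    by (intro rtrancl_subset_rtrancl subrelI)
  then have B: "(x, y) \<in> ?A\<^sup>*" if "(\<phi> x, \<phi> y) \<in> ?B\<^sup>*" for x y
    using rtrancl_trans[OF rtrancl_trans[OF to_phi] adj_sym[OF to_phi]] that by blast
  have "component ((`) \<phi> ` F) (\<phi> x) \<subseteq> V - {v}"
    by (rule component_subset) (use F V in \<open>auto simp: \<phi>_def edges_on_def\<close>)
  moreover have "y \<in> component ((`) \<phi> ` F) (\<phi> x) \<longleftrightarrow> y \<in> component (insert {u, v} F) x"
    if "y \<noteq> v" for y
    using A[of x y] B[of x y] that by (auto simp: component_def \<phi>_def)
  ultimately show ?thesis by blast
qed

lemma components_contract:
  assumes F: "F \<subseteq> edges_on V" and V: "u \<in> V" "v \<in> V" "u \<noteq> v"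
  defines "\<phi> \<equiv> \<lambda>x. if x = v then u else x"
  shows "components (V - {v}) ((`) \<phi> ` F) = (\<lambda>C. C - {v}) ` components V (insert {u, v} F)"
proof -
  have "\<phi> ` V = V - {v}"
    using V by (auto simp: \<phi>_def)
  then have "components (V - {v}) ((`) \<phi> ` F) = (\<lambda>x. component ((`) \<phi> ` F) (\<phi> x)) ` V"
    by (metis components_def image_image)
  also have "\<dots> = (\<lambda>x. component (insert {u, v} F) x - {v}) ` V"
    unfolding \<phi>_def by (rule image_cong[OF refl]) (rule component_contract[OF F V])
  finally show ?thesis by (simp add: components_def image_image)
qed

section \<open>The subset expansion of the weighted chromatic polynomial\<close>

lemma sum_Pow_insert:
  assumes "finite A" "x \<notin> A"
  shows "(\<Sum>B\<in>Pow (insert x A). h B) = (\<Sum>B\<in>Pow A. h B + h (insert x B))"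
proof -
  have "inj_on (insert x) (Pow A)"
    using assms(2) by (auto simp: inj_on_def)
  then show ?thesis
    using assms by (subst Pow_insert, subst sum.union_disjoint)
      (auto simp: sum.reindex sum.distrib)
qed

lemma sum_Pow_disjoint_Un:
  assumes "A \<inter> B = {}"
  shows "(\<Sum>F\<in>Pow (A \<union> B). h F) = (\<Sum>F\<in>Pow A. \<Sum>G\<in>Pow B. h (F \<union> G))"
  unfolding sum.cartesian_product
  by (rule sum.reindex_bij_witness[of _ "\<lambda>(F, G). F \<union> G" "\<lambda>F. (F \<inter> A, F \<inter> B)"])
     (use assms in \<open>auto simp: Int_Un_distrib2 Int_absorb2 simp flip: Int_Un_distrib\<close>)

lemma sum_power_card:
  fixes y :: "'r::comm_ring_1"
  assumes "finite A" shows "(\<Sum>B\<in>Pow A. y ^ card B) = (1 + y) ^ card A"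
  using assms
proof (induction A rule: finite_induct)
  case (insert x A)
  have "(\<Sum>B\<in>Pow (insert x A). y ^ card B) = (\<Sum>B\<in>Pow A. y ^ card B * (1 + y))"
    unfolding sum_Pow_insert[OF insert(1,2)]
  proof (rule sum.cong)
    fix B assume "B \<in> Pow A"
    then have "finite B" "x \<notin> B" using insert(1,2) finite_subset[of B A] by auto
    then show "y ^ card B + y ^ card (insert x B) = y ^ card B * (1 + y)"
      by (simp add: algebra_simps)
  qed simp
  then show ?case using insert by (simp add: mult.commute flip: sum_distrib_left)
qed simp

text \<open>If \<open>x\<close> and \<open>z\<close> have the same image, then adjoining \<open>x\<close>, \<open>z\<close> or both to a set has the same
  effect on the image, with total sign \<open>-1 - 1 + 1 = -1\<close>, as for a single element.  This is why parallel
  edges that arise in a contraction may be merged.\<close>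

lemma alternating_sum_image:
  fixes g :: "'b set \<Rightarrow> 'r::comm_ring_1"
  assumes "finite A"
  shows "(\<Sum>B\<in>Pow A. (-1) ^ card B * g (f ` B)) = (\<Sum>B\<in>Pow (f ` A). (-1) ^ card B * g B)"
  using assms
proof (induction A arbitrary: g rule: finite_induct)
  case (insert x A)
  let ?g = "\<lambda>B. g B - g (insert (f x) B)"
  have "(\<Sum>B\<in>Pow (insert x A). (-1) ^ card B * g (f ` B)) =
      (\<Sum>B\<in>Pow A. (-1) ^ card B * ?g (f ` B))"
    unfolding sum_Pow_insert[OF insert(1,2)]
  proof (rule sum.cong)
    fix B assume B: "B \<in> Pow A"
    then have "finite B" "x \<notin> B" using insert(1,2) finite_subset[of B A] by auto
    then show "(-1) ^ card B * g (f ` B) + (-1) ^ card (insert x B) * g (f ` insert x B) =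
        (-1) ^ card B * ?g (f ` B)"
      by (simp add: algebra_simps)
  qed simp
  also have "\<dots> = (\<Sum>B\<in>Pow (f ` A). (-1) ^ card B * ?g B)"
    by (rule insert.IH)
  also have "\<dots> = (\<Sum>B\<in>Pow (insert (f x) (f ` A)). (-1) ^ card B * g B)"
  proof (cases "f x \<in> f ` A")
    case False
    have "finite (f ` A)" using insert by simp
    show ?thesis
      unfolding sum_Pow_insert[OF \<open>finite (f ` A)\<close> False]
    proof (rule sum.cong)
      fix B assume B: "B \<in> Pow (f ` A)"
      then have "finite B" "f x \<notin> B" using insert(1) False finite_subset[of B "f ` A"] by auto
      then show "(-1) ^ card B * ?g B =
          (-1) ^ card B * g B + (-1) ^ card (insert (f x) B) * g (insert (f x) B)"
        by (simp add: algebra_simps)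
    qed simp
  next
    case True
  \<comment> \<open>The element \<open>f x\<close> occurs already in \<open>f ` A\<close>, so that the terms with \<open>insert (f x) B\<close> cancel in pairs.\<close>
    define D where "D = f ` A - {f x}"
    have D: "finite D" "f x \<notin> D" "f ` A = insert (f x) D"
      using insert True by (auto simp: D_def)
    have "(\<Sum>B\<in>Pow (f ` A). (-1) ^ card B * g (insert (f x) B)) = 0"
      unfolding D(3) sum_Pow_insert[OF D(1,2)]
    proof (rule sum.neutral, safe)
      fix B assume "B \<subseteq> D"
      then have "finite B" "f x \<notin> B" using D finite_subset[of B D] by auto
      then show "(-1) ^ card B * g (insert (f x) B) +
          (-1) ^ card (insert (f x) B) * g (insert (f x) (insert (f x) B)) = 0"
        by simp
    qed
    then show ?thesis
      using True by (simp add: insert_absorb right_diff_distrib sum_subtractf)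
  qed
  finally show ?case by simp
qed simp

text \<open>The subset expansion of the weighted chromatic polynomial is the case \<open>y = -1\<close>:
  the sign \<open>(-1)\<^bsup>|F| - |V| + k\<^esup>\<close> of the term of an edge set \<open>F\<close> with \<open>k\<close> components is distributed over
  \<open>|V|\<close>, the edges of \<open>F\<close> and the components.  The case \<open>y = -1/2\<close> arises from summation over all
  graphs on \<open>V\<close>.\<close>

definition edge_sum :: "(nat \<Rightarrow> 'r::comm_ring_1) \<Rightarrow> ('a \<Rightarrow> nat) \<Rightarrow> 'r \<Rightarrow> 'a set \<Rightarrow> 'a set set \<Rightarrow> 'r" where
  "edge_sum q w y V E =
     (-1) ^ card V * (\<Sum>F\<in>Pow E. y ^ card F * (\<Prod>C\<in>components V F. - q (sum w C)))"

lemma edge_sum_no_edges: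
  assumes "finite V" shows "edge_sum q w y V {} = (\<Prod>v\<in>V. q (w v))"
proof -
  have "component {} x = {x}" for x :: 'a
    by (auto simp: component_def adj_def)
  then have "components V {} = (\<lambda>x. {x}) ` V"
    by (auto simp: components_def)
  then have "edge_sum q w y V {} = (-1) ^ card V * (\<Prod>x\<in>V. - q (w x))"
    by (simp add: edge_sum_def prod.reindex)
  also have "\<dots> = (\<Prod>x\<in>V. (-1) * (- q (w x)))"
    by (simp only: prod.distrib prod_constant)
  finally show ?thesis by simp
qed

text \<open>The terms without the edge \<open>{u, v}\<close> belong to the graph with this edge deleted.  In a term with this
  edge, contraction keeps the components and their weights and lowers both the number of edges and the
  number of vertices by one, so that the sign is kept as well.\<close>

lemma edge_sum_deletion_contraction:
  assumes V: "finite V" and E: "E \<subseteq> edges_on V" and e: "{u, v} \<in> E" "u \<noteq> v"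
  shows "edge_sum q w (-1) V E = edge_sum q w (-1) V (E - {{u, v}}) +
           edge_sum q (w(u := w u + w v)) (-1) (V - {v}) (contract_edges u v E)"
proof -
  define \<phi> where "\<phi> x = (if x = v then u else x)" for x
  define D where "D = E - {{u, v}}"
  let ?w = "w(u := w u + w v)"
  let ?g = "\<lambda>F. \<Prod>C\<in>components V F. - q (sum w C)"
  let ?h = "\<lambda>H. \<Prod>C\<in>components (V - {v}) H. - q (sum ?w C)"
  have fin: "finite E" using V E by (rule finite_subset_edges_on)
  have D: "finite D" "{u, v} \<notin> D" "E = insert {u, v} D"
    using e fin by (auto simp: D_def)
  have uv: "u \<in> V" "v \<in> V" using e E by (auto simp: edges_on_def)
  have contract: "contract_edges u v E = (`) \<phi> ` D"
    by (simp add: contract_edges_def D_def \<phi>_def)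
  have gh: "?g (insert {u, v} F) = ?h ((`) \<phi> ` F)" if "F \<subseteq> D" for F
  proof -
    let ?K = "components V (insert {u, v} F)"
    have F: "F \<subseteq> edges_on V" using that E by (auto simp: D_def)
    then have K_sub: "insert {u, v} F \<subseteq> Pow V" using uv by (auto simp: edges_on_def)
    have uv_iff: "u \<in> C \<longleftrightarrow> v \<in> C" if C: "C \<in> ?K" for C
    proof -
      have "(u, v) \<in> adj (insert {u, v} F)" by (simp add: adj_def)
      then have "v \<in> component (insert {u, v} F) u" by (auto simp: component_def)
      then have eq: "component (insert {u, v} F) v = component (insert {u, v} F) u"
        by (rule component_eq)
      obtain x where "C = component (insert {u, v} F) x" using C by (auto simp: components_def)
      then show ?thesis using eq component_eq component_refl by metis
    qed
  \<comment> \<open>Whether \<open>v\<close> was in a component can be read off from \<open>u\<close>.\<close>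
    have inj: "inj_on (\<lambda>C. C - {v}) ?K"
    proof (rule inj_onI)
      fix B C assume BC: "B \<in> ?K" "C \<in> ?K" and eq: "B - {v} = C - {v}"
      then have "v \<in> B \<longleftrightarrow> v \<in> C" using uv_iff[OF BC(1)] uv_iff[OF BC(2)] e(2) by blast
      then show "B = C" using eq by blast
    qed
    have sum: "sum ?w (C - {v}) = sum w C" if C: "C \<in> ?K" for C
    proof -
      have fin: "finite C" using components_subset[OF K_sub C] V finite_subset[of C V] by auto
      show ?thesis
      proof (cases "v \<in> C")
        case True
        define B where "B = C - {u, v}"
        have B: "C - {v} = insert u B" "C = insert v (insert u B)" "u \<notin> B" "v \<notin> B" "finite B"
          using True uv_iff[OF C] e(2) fin by (auto simp: B_def)
        have "sum ?w B = sum w B" using B by (intro sum.cong) auto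
        then show ?thesis unfolding B(1) using B e(2) by (subst B(2)) simp
      next
        case False
        then have C': "C - {v} = C" "u \<notin> C" using uv_iff[OF C] by auto
        then show ?thesis unfolding C'(1) by (intro sum.cong) auto
      qed
    qed
    have "?h ((`) \<phi> ` F) = (\<Prod>C\<in>(\<lambda>C. C - {v}) ` ?K. - q (sum ?w C))"
      using components_contract[OF F uv e(2)] by (simp add: \<phi>_def[abs_def])
    also have "\<dots> = ?g (insert {u, v} F)"
      unfolding prod.reindex[OF inj] by (intro prod.cong refl) (simp only: sum o_apply)
    finally show ?thesis by simp
  qed
  have "(\<Sum>F\<in>Pow E. (-1) ^ card F * ?g F) =
      (\<Sum>F\<in>Pow D. (-1) ^ card F * ?g F) + (\<Sum>F\<in>Pow D. (-1) ^ card (insert {u, v} F) * ?g (insert {u, v} F))"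
    unfolding D(3) sum_Pow_insert[OF D(1,2)] by (rule sum.distrib)
  also have "(\<Sum>F\<in>Pow D. (-1) ^ card (insert {u, v} F) * ?g (insert {u, v} F)) =
      (\<Sum>F\<in>Pow D. - ((-1) ^ card F * ?h ((`) \<phi> ` F)))"
  proof (rule sum.cong)
    fix F assume F: "F \<in> Pow D"
    then have "finite F" "{u, v} \<notin> F" using D finite_subset[of F D] by auto
    then show "(-1) ^ card (insert {u, v} F) * ?g (insert {u, v} F) =
        - ((-1) ^ card F * ?h ((`) \<phi> ` F))"
      using F gh by simp
  qed simp
  also have "\<dots> = - (\<Sum>H\<in>Pow ((`) \<phi> ` D). (-1) ^ card H * ?h H)"
    unfolding sum_negf by (simp only: alternating_sum_image[OF D(1), of ?h])
  finally have main: "(\<Sum>F\<in>Pow E. (-1) ^ card F * ?g F) =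
      (\<Sum>F\<in>Pow D. (-1) ^ card F * ?g F) - (\<Sum>H\<in>Pow ((`) \<phi> ` D). (-1) ^ card H * ?h H)"
    by simp
  have "card V = Suc (card (V - {v}))" using V uv by (metis card_Suc_Diff1)
  then show ?thesis
    unfolding edge_sum_def contract main D_def[symmetric] by (simp add: algebra_simps)
qed

lemma simple_graph_contract:
  assumes "simple_graph (V, E)" "{u, v} \<in> E" "u \<noteq> v"
  shows "simple_graph (V - {v}, contract_edges u v E)"
proof -
  have E: "E \<subseteq> edges_on V" "finite V" using assms by (auto simp: simple_graph_iff)
  let ?f = "\<lambda>x. if x = v then u else x"
  have uv: "u \<in> V" "v \<in> V" using assms E by (auto simp: edges_on_def)
  have "?f ` e \<in> edges_on (V - {v})" if e: "e \<in> E" "e \<noteq> {u, v}" for e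
  proof -
    obtain x y where xy: "e = {x, y}" "x \<noteq> y" "x \<in> V" "y \<in> V"
      using e(1) E(1) by (blast elim: edges_onE)
    define a b where "a = ?f x" and "b = ?f y"
    have "a \<noteq> b" using e xy by (auto simp: a_def b_def)
    moreover have "a \<in> V - {v}" "b \<in> V - {v}"
      using xy uv assms(3) by (simp_all add: a_def b_def)
    moreover have "?f ` e = {a, b}" using xy by (simp add: a_def b_def)
    ultimately show ?thesis by (simp add: edges_on_def)
  qed
  then show ?thesis using E by (auto simp: simple_graph_iff contract_edges_def)
qed

lemma wchrom_eq_edge_sum:
  "wchrom V E w P \<Longrightarrow> simple_graph (V, E) \<Longrightarrow> P = edge_sum qvar w (-1) V E"
proof (induction rule: wchrom.induct)
  case (no_edges V w)
  then show ?case by (simp add: edge_sum_no_edges simple_graph_iff)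
next
  case (edge u v E V w P Q)
  have "simple_graph (V, E - {{u, v}})" using edge.prems by (auto simp: simple_graph_iff)
  then show ?case
    using edge simple_graph_contract[OF edge.prems edge(1,2)]
      edge_sum_deletion_contraction[of V E u v qvar w] by (simp add: simple_graph_iff del: fun_upd_apply)
qed

lemma wchrom_exists: "simple_graph (V, E) \<Longrightarrow> \<exists>P. wchrom V E w P"
proof (induction "card E" arbitrary: V E w rule: less_induct)
  case less
  have fin: "finite V" "E \<subseteq> edges_on V" "finite E"
    using less.prems finite_subset_edges_on by (auto simp: simple_graph_iff)
  show ?case
  proof (cases "E = {}")
    case True
    then show ?thesis using wchrom.no_edges by blast
  next
    case False
    then obtain u v where uv: "{u, v} \<in> E" "u \<noteq> v"
      using fin(2) by (blast elim: edges_onE)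
    have card: "card (E - {{u, v}}) < card E" using fin uv by (intro card_Diff1_less)
    have "card (contract_edges u v E) \<le> card (E - {{u, v}})"
      unfolding contract_edges_def using fin by (intro card_image_le) auto
    then obtain Q where "wchrom (V - {v}) (contract_edges u v E) (w(u := w u + w v)) Q"
      using less.hyps[OF _ simple_graph_contract[OF less.prems uv]] card by fastforce
    moreover have "simple_graph (V, E - {{u, v}})" using less.prems by (auto simp: simple_graph_iff)
    then obtain P where "wchrom V (E - {{u, v}}) w P" using less.hyps[OF card] by blast
    ultimately show ?thesis using wchrom.edge[OF uv] by blast
  qed
qed

lemma weighted_chromatic_poly_eq:
  assumes "simple_graph (V, E)"
  shows "weighted_chromatic_poly (V, E) w = edge_sum qvar w (-1) V E"
  using assms wchrom_exists[OF assms] wchrom_eq_edge_sum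
  unfolding weighted_chromatic_poly_def fst_conv snd_conv by (metis the_equality)

lemma edge_sum_image:
  assumes f: "inj_on f V" and E: "E \<subseteq> Pow V"
  shows "edge_sum q (\<lambda>_. 1) y (f ` V) ((`) f ` E) = edge_sum q (\<lambda>_. 1) y V E"
proof -
  have inj: "inj_on ((`) f) (Pow V)" using f by (rule inj_on_image_Pow)
  then have injE: "inj_on ((`) f) E" using E by (rule inj_on_subset)
  have "(\<Sum>F\<in>Pow ((`) f ` E). y ^ card F * (\<Prod>C\<in>components (f ` V) F. - q (card C))) =
      (\<Sum>F\<in>Pow E. y ^ card ((`) f ` F) * (\<Prod>C\<in>components (f ` V) ((`) f ` F). - q (card C)))"
    unfolding image_Pow_surj[OF refl, of "(`) f" E, symmetric]
    by (rule sum.reindex_cong[OF inj_on_image_Pow[OF injE] refl refl])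
  also have "\<dots> = (\<Sum>F\<in>Pow E. y ^ card F * (\<Prod>C\<in>components V F. - q (card C)))"
  proof (rule sum.cong)
    fix F assume "F \<in> Pow E"
    then have F: "F \<subseteq> Pow V" "F \<subseteq> E" using E by auto
    have sub: "C \<subseteq> V" if "C \<in> components V F" for C using components_subset[OF F(1) that] by simp
    then have "components V F \<subseteq> Pow V" by auto
    then have "inj_on ((`) f) (components V F)" using inj inj_on_subset by blast
    then have "(\<Prod>C\<in>components (f ` V) ((`) f ` F). - q (card C)) =
        (\<Prod>C\<in>components V F. - q (card (f ` C)))"
      unfolding components_image[OF f F(1)] by (simp add: prod.reindex)
    also have "\<dots> = (\<Prod>C\<in>components V F. - q (card C))"
      using sub by (intro prod.cong refl) (metis card_image f inj_on_subset)
    finally have "(\<Prod>C\<in>components (f ` V) ((`) f ` F). - q (card C)) =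
        (\<Prod>C\<in>components V F. - q (card C))" .
    moreover have "card ((`) f ` F) = card F"
      using injE F(2) by (meson card_image inj_on_subset)
    ultimately show "y ^ card ((`) f ` F) * (\<Prod>C\<in>components (f ` V) ((`) f ` F). - q (card C)) =
        y ^ card F * (\<Prod>C\<in>components V F. - q (card C))" by simp
  qed simp
  finally show ?thesis
    using card_image[OF f] by (simp add: edge_sum_def)
qed

lemma prod_components_disjoint_Un:
  assumes ST: "S \<inter> T = {}" "finite S" "finite T" and F: "F1 \<subseteq> Pow S" "F2 \<subseteq> Pow T"
  shows "(\<Prod>C\<in>components (S \<union> T) (F1 \<union> F2). g C) =
    (\<Prod>C\<in>components S F1. g C) * (\<Prod>C\<in>components T F2. g C)"
proof -
  have "components S F1 \<inter> components T F2 = {}"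
    using components_subset[OF F(1)] components_subset[OF F(2)] ST(1) by blast
  moreover have "finite (components S F1)" "finite (components T F2)"
    using ST by (auto simp: components_def)
  ultimately show ?thesis
    unfolding components_disjoint_Un[OF ST(1) F] by (simp add: prod.union_disjoint)
qed

lemma card_Un_edges:
  assumes ST: "S \<inter> T = {}" "finite S" "finite T" and F: "F1 \<subseteq> edges_on S" "F2 \<subseteq> edges_on T"
  shows "card (F1 \<union> F2) = card F1 + card F2"
  using edges_on_disjoint[OF ST(1)] F
  by (intro card_Un_disjoint finite_subset_edges_on[OF ST(2) F(1)] finite_subset_edges_on[OF ST(3) F(2)])
     blast

lemma edge_sum_disjoint_Un:
  assumes ST: "S \<inter> T = {}" "finite S" "finite T" and E: "E1 \<subseteq> edges_on S" "E2 \<subseteq> edges_on T"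
  shows "edge_sum q w y (S \<union> T) (E1 \<union> E2) = edge_sum q w y S E1 * edge_sum q w y T E2"
proof -
  let ?g = "\<lambda>V F. \<Prod>C\<in>components V F. - q (sum w C)"
  have disj: "E1 \<inter> E2 = {}" using edges_on_disjoint[OF ST(1)] E by blast
  have "(\<Sum>F\<in>Pow (E1 \<union> E2). y ^ card F * ?g (S \<union> T) F) =
      (\<Sum>F1\<in>Pow E1. \<Sum>F2\<in>Pow E2. y ^ card (F1 \<union> F2) * ?g (S \<union> T) (F1 \<union> F2))"
    by (rule sum_Pow_disjoint_Un[OF disj])
  also have "\<dots> = (\<Sum>F1\<in>Pow E1. \<Sum>F2\<in>Pow E2. (y ^ card F1 * ?g S F1) * (y ^ card F2 * ?g T F2))"
  proof (intro sum.cong refl)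
    fix F1 F2 assume "F1 \<in> Pow E1" "F2 \<in> Pow E2"
    then have F: "F1 \<subseteq> edges_on S" "F2 \<subseteq> edges_on T" using E by auto
    then have F': "F1 \<subseteq> Pow S" "F2 \<subseteq> Pow T" using edges_on_subset_Pow by blast+
    show "y ^ card (F1 \<union> F2) * ?g (S \<union> T) (F1 \<union> F2) =
        (y ^ card F1 * ?g S F1) * (y ^ card F2 * ?g T F2)"
      unfolding card_Un_edges[OF ST F] prod_components_disjoint_Un[OF ST F']
      by (simp add: power_add algebra_simps)
  qed
  also have "\<dots> = (\<Sum>F\<in>Pow E1. y ^ card F * ?g S F) * (\<Sum>F\<in>Pow E2. y ^ card F * ?g T F)"
    by (rule sum_product[symmetric])
  finally show ?thesis
    using ST by (simp add: edge_sum_def card_Un_disjoint power_add algebra_simps)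
qed

section \<open>Summation over all graphs by the component of a vertex\<close>

text \<open>The edge sets of the connected graphs with vertex set \<open>S\<close>.\<close>

definition connected_on :: "'a set \<Rightarrow> 'a set set set" where
  "connected_on S = {E. E \<subseteq> edges_on S \<and> connected_graph (S, E)}"

text \<open>A graph on \<open>V\<close> amounts to the vertex set \<open>S\<close> of the component of \<open>v\<close>, a connected graph on \<open>S\<close>, and
  an arbitrary graph on \<open>V - S\<close>.\<close>

lemma sum_over_component:
  assumes V: "finite V" "v \<in> V"
  shows "(\<Sum>E\<in>Pow (edges_on V). f E) =
    (\<Sum>S | S \<subseteq> V \<and> v \<in> S. \<Sum>E1\<in>connected_on S. \<Sum>E2\<in>Pow (edges_on (V - S)). f (E1 \<union> E2))"
proof -
  let ?A = "SIGMA S:{S. S \<subseteq> V \<and> v \<in> S}. connected_on S \<times> Pow (edges_on (V - S))"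
  have fin_conn: "finite (connected_on S)" if "S \<subseteq> V" for S
    using that V finite_subset[of S V]
    by (intro finite_subset[of "connected_on S" "Pow (edges_on S)"]) (auto simp: connected_on_def)
  have "(\<Sum>E\<in>Pow (edges_on V). f E) = (\<Sum>(S, E1, E2)\<in>?A. f (E1 \<union> E2))"
  proof (rule sum.reindex_bij_witness[of _ "\<lambda>(S, E1, E2). E1 \<union> E2"
        "\<lambda>E. (component E v, E \<inter> Pow (component E v), E - Pow (component E v))"], goal_cases)
    case (1 E)
    then show ?case by auto
  next
    case (2 E)
    then have E: "E \<subseteq> edges_on V" "E \<subseteq> Pow V" using edges_on_subset_Pow[of V] by auto
    let ?S = "component E v"
    have S: "?S \<subseteq> V" "v \<in> ?S" using component_subset[OF E(2) V(2)] by auto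
    have out: "e \<subseteq> V - ?S" if e: "e \<in> E" "\<not> e \<subseteq> ?S" for e
    proof -
      obtain x y where xy: "e = {x, y}" using e(1) E(1) by (blast elim: edges_onE)
      then have "(x, y) \<in> (adj E)\<^sup>*" "(y, x) \<in> (adj E)\<^sup>*"
        using e by (auto simp: adj_def insert_commute)
      then have "x \<in> ?S \<longleftrightarrow> y \<in> ?S"
        by (auto simp: component_def intro: rtrancl_trans)
      then show ?thesis using xy e E by auto
    qed
    have "y \<in> component (E \<inter> Pow ?S) v" if "y \<in> ?S" for y
    proof -
      have "(v, y) \<in> (adj E)\<^sup>*" using that by (simp add: component_def)
      then show ?thesis
      proof (induction rule: rtrancl_induct)
        case (step y z)
        then have "y \<in> ?S" "z \<in> ?S" by (auto simp: component_def intro: rtrancl_into_rtrancl)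
        then have "(y, z) \<in> adj (E \<inter> Pow ?S)" using step(2) by (simp add: adj_def)
        then show ?case using step(3) by (auto simp: component_def intro: rtrancl_into_rtrancl)
      qed simp
    qed
    then have "?S \<subseteq> component (E \<inter> Pow ?S) v" by blast
    moreover have sub: "E \<inter> Pow ?S \<subseteq> Pow ?S" by auto
    ultimately have "component (E \<inter> Pow ?S) v = ?S" using component_subset[OF sub S(2)] by blast
    then have "component (E \<inter> Pow ?S) x = ?S" if "x \<in> ?S" for x
      using component_eq[of x "E \<inter> Pow ?S" v] that by simp
    then have "connected_graph (?S, E \<inter> Pow ?S)"
      using connected_graph_iff[OF sub] S(2) by blast
    moreover have "E \<inter> Pow ?S \<subseteq> edges_on ?S" "E - Pow ?S \<subseteq> edges_on (V - ?S)"
      using E out unfolding edges_on_def by blast+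
    ultimately show ?case using S by (auto simp: connected_on_def)
  next
    case (3 x)
    then obtain S E1 E2 where x: "x = (S, E1, E2)" and S: "S \<subseteq> V" "v \<in> S"
      and E: "E1 \<subseteq> edges_on S" "connected_graph (S, E1)" "E2 \<subseteq> edges_on (V - S)"
      by (auto simp: connected_on_def)
    have E': "E1 \<subseteq> Pow S" "E2 \<subseteq> Pow (V - S)" "{} \<notin> E2"
      using E edges_on_subset_Pow edges_on_nonempty by blast+
    have "component (E1 \<union> E2) v = component E1 v"
      by (rule component_disjoint_Un[of S "V - S"]) (use E' S in auto)
    also have "\<dots> = S" using connected_graph_iff[OF E'(1)] E(2) S(2) by blast
    finally have comp: "component (E1 \<union> E2) v = S" .
    have "e = {}" if "e \<in> E2" "e \<subseteq> S" for e using that E' by blast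
    then have "(E1 \<union> E2) \<inter> Pow S = E1" "(E1 \<union> E2) - Pow S = E2" using E' by blast+
    then show ?case by (simp add: x comp)
  next
    case (4 x)
    then obtain S E1 E2 where x: "x = (S, E1, E2)" and S: "S \<subseteq> V"
      and E: "E1 \<subseteq> edges_on S" "E2 \<subseteq> edges_on (V - S)"
      by (auto simp: connected_on_def)
    have "edges_on S \<subseteq> edges_on V" "edges_on (V - S) \<subseteq> edges_on V"
      using S by (auto intro!: edges_on_mono)
    then show ?case using E by (auto simp: x)
  next
    case (5 E)
    have "E \<inter> Pow (component E v) \<union> (E - Pow (component E v)) = E" by blast
    then show ?case by simp
  qed
  also have "\<dots> = (\<Sum>S | S \<subseteq> V \<and> v \<in> S. \<Sum>(E1, E2)\<in>connected_on S \<times> Pow (edges_on (V - S)). f (E1 \<union> E2))"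
    using V fin_conn by (subst sum.Sigma) (auto simp: case_prod_unfold intro: finite_subset)
  finally show ?thesis by (simp add: sum.cartesian_product)
qed

lemma sum_subsets_containing:
  fixes h :: "nat \<Rightarrow> 'r::comm_ring_1"
  assumes V: "finite V" "v \<in> V"
  shows "(\<Sum>S | S \<subseteq> V \<and> v \<in> S. h (card S)) =
           (\<Sum>k=1..card V. of_nat ((card V - 1) choose (k - 1)) * h k)"
proof -
  let ?U = "V - {v}"
  have U: "finite ?U" "card ?U = card V - 1" "card V = Suc (card ?U)"
    using V card_Suc_Diff1[OF V] by simp_all
  have "(\<Sum>S | S \<subseteq> V \<and> v \<in> S. h (card S)) = (\<Sum>S\<in>Pow ?U. h (Suc (card S)))"
  proof (rule sum.reindex_bij_witness[of _ "insert v" "\<lambda>S. S - {v}"], goal_cases)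
    case (5 S)
    then have "finite S" using V finite_subset[of S V] by auto
    then show ?case using 5 by (metis card_Suc_Diff1 mem_Collect_eq)
  qed (use V in auto)
  also have "\<dots> = (\<Sum>k\<le>card ?U. \<Sum>S | S \<in> Pow ?U \<and> card S = k. h (Suc (card S)))"
    using U(1) card_mono[OF U(1)] by (intro sum.group[symmetric]) auto
  also have "\<dots> = (\<Sum>k\<le>card ?U. of_nat (card ?U choose k) * h (Suc k))"
  proof (rule sum.cong)
    fix k
    have "(\<Sum>S | S \<in> Pow ?U \<and> card S = k. h (Suc (card S))) = (\<Sum>S | S \<subseteq> ?U \<and> card S = k. h (Suc k))"
      by (intro sum.cong) auto
    then show "(\<Sum>S | S \<in> Pow ?U \<and> card S = k. h (Suc (card S))) = of_nat (card ?U choose k) * h (Suc k)"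
      using n_subsets[OF U(1), of k] by simp
  qed simp
  also have "\<dots> = (\<Sum>k=1..card V. of_nat ((card V - 1) choose (k - 1)) * h k)"
    unfolding U(3)
    by (rule sum.reindex_bij_witness[of _ "\<lambda>k. k - 1" Suc]) auto
  finally show ?thesis .
qed

section \<open>From isomorphism classes to labelled graphs\<close>

lemma graph_term_eq:
  assumes "simple_graph (V, E)"
  shows "graph_term (V, E) =
    mfps_smult (1 / of_nat (card (Aut (V, E)))) (edge_sum mfps_var (\<lambda>_. 1) (-1) V E)"
  unfolding graph_term_def weighted_chromatic_poly_eq[OF assms] edge_sum_def
  by (simp add: mfps_of_mpoly_sum mfps_of_mpoly_prod mfps_of_mpoly_power)

lemma homogeneous_edge_sum:
  assumes V: "finite V" "E \<subseteq> Pow V" and y: "homogeneous 0 y"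
  shows "homogeneous (card V) (edge_sum mfps_var (\<lambda>_. 1) y V E)"
proof -
  have "homogeneous (card V) (\<Prod>C\<in>components V F. - mfps_var (sum (\<lambda>_. 1) C))" if "F \<subseteq> E" for F
  proof -
    have F: "F \<subseteq> Pow V" using that V by auto
    have "finite C" if "C \<in> components V F" for C
      using components_subset[OF F that] V finite_subset by blast
    moreover have "disjoint (components V F)"
      unfolding disjoint_def using disjoint_components by blast
    ultimately have "sum card (components V F) = card V"
      using card_Union_disjoint[of "components V F"] Union_components[OF F] by simp
    moreover have "homogeneous (sum card (components V F))
        (\<Prod>C\<in>components V F. - mfps_var (sum (\<lambda>_. 1) C))"
      by (rule homogeneous_prod)
        (use V in \<open>auto simp: components_def intro: homogeneous_uminus homogeneous_var\<close>)
    ultimately show ?thesis by simp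
  qed
  then have "homogeneous (0 + card V)
      (\<Sum>F\<in>Pow E. y ^ card F * (\<Prod>C\<in>components V F. - mfps_var (sum (\<lambda>_. 1) C)))"
    using homogeneous_mult[OF homogeneous_0_power[OF y]]
    by (intro homogeneous_sum) auto
  moreover have "homogeneous 0 ((-1) ^ card V)"
    by (intro homogeneous_0_power homogeneous_uminus homogeneous_1)
  ultimately show ?thesis
    unfolding edge_sum_def using homogeneous_mult by fastforce
qed

lemma image_image_edges: "(`) g ` (`) f ` E = (`) (g \<circ> f) ` E"
  by (simp add: image_image image_comp)

lemma image_edges_id:
  assumes "E \<subseteq> Pow V" "\<And>x. x \<in> V \<Longrightarrow> f x = x" shows "(`) f ` E = E"
proof -
  have "f ` e = e" if "e \<in> E" for e
    using that assms by (auto simp: image_def subset_iff)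
  then show ?thesis by simp
qed

lemma image_edges_cong:
  assumes "E \<subseteq> Pow V" "\<And>x. x \<in> V \<Longrightarrow> f x = g x" shows "(`) f ` E = (`) g ` E"
  using assms by (intro image_cong refl) auto

lemma image_edges_on:
  assumes "inj_on f V" "E \<subseteq> edges_on V" shows "(`) f ` E \<subseteq> edges_on (f ` V)"
proof
  fix e' assume "e' \<in> (`) f ` E"
  then obtain e where e: "e \<subseteq> V" "card e = 2" "e' = f ` e"
    using assms(2) by (auto simp: edges_on_def)
  then have "card (f ` e) = 2" using assms(1) card_image inj_on_subset by metis
  then show "e' \<in> edges_on (f ` V)" using e by (auto simp: edges_on_def)
qed

lemma card_Aut_image:
  assumes f: "bij_betw f V V'" and E: "E \<subseteq> Pow V"
  shows "card (Aut (V', (`) f ` E)) = card (Aut (V, E))"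
proof -
  define \<Phi> where "\<Phi> \<pi> x = (if x \<in> V' then f (\<pi> (inv_into V f x)) else x)" for \<pi> x
  have bij: "bij_betw \<Phi> {\<pi>. \<pi> permutes V} {\<pi>. \<pi> permutes V'}"
    using bij_betw_permutations[OF f] by (simp add: \<Phi>_def[abs_def])
  have inj: "inj_on f V" "f ` V = V'" using f by (auto simp: bij_betw_def)
  have iff: "(`) (\<Phi> \<pi>) ` (`) f ` E = (`) f ` E \<longleftrightarrow> (`) \<pi> ` E = E" if \<pi>: "\<pi> permutes V" for \<pi>
  proof -
    have "(`) (\<Phi> \<pi>) ` (`) f ` E = (`) f ` (`) \<pi> ` E"
      unfolding image_image_edges
      using inj by (intro image_edges_cong[OF E]) (auto simp: \<Phi>_def inv_into_f_f)
    moreover have "(`) \<pi> ` E \<subseteq> Pow V"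
      using E permutes_image[OF \<pi>] by auto
    ultimately show ?thesis
      using inj_on_image_eq_iff[OF inj_on_image_Pow[OF inj(1)], of "(`) \<pi> ` E" E] E by simp
  qed
  have "\<Phi> ` Aut (V, E) = Aut (V', (`) f ` E)"
  proof (intro equalityI subsetI)
    fix \<sigma> assume "\<sigma> \<in> \<Phi> ` Aut (V, E)"
    then obtain \<pi> where "\<sigma> = \<Phi> \<pi>" "\<pi> permutes V" "(`) \<pi> ` E = E"
      by (auto simp: Aut_def)
    then show "\<sigma> \<in> Aut (V', (`) f ` E)"
      using iff bij_betwE[OF bij] by (simp add: Aut_def)
  next
    fix \<sigma> assume \<sigma>: "\<sigma> \<in> Aut (V', (`) f ` E)"
    then have "\<sigma> \<in> \<Phi> ` {\<pi>. \<pi> permutes V}"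
      using bij_betw_imp_surj_on[OF bij] by (simp add: Aut_def)
    then obtain \<pi> where \<pi>: "\<pi> permutes V" "\<sigma> = \<Phi> \<pi>" by blast
    then have "\<pi> \<in> Aut (V, E)" using \<sigma> iff by (simp add: Aut_def)
    then show "\<sigma> \<in> \<Phi> ` Aut (V, E)" using \<pi>(2) by blast
  qed
  moreover have "inj_on \<Phi> (Aut (V, E))"
    using bij_betw_imp_inj_on[OF bij] by (rule inj_on_subset) (auto simp: Aut_def)
  ultimately show ?thesis by (metis card_image)
qed

text \<open>The orbit-stabilizer theorem for the action of the permutations of \<open>V\<close> on graphs.\<close>

lemma fact_eq_card_orbit_Aut:
  assumes V: "finite V" and E: "E \<subseteq> Pow V"
  shows "fact (card V) = card {(`) \<pi> ` E | \<pi>. \<pi> permutes V} * card (Aut (V, E))"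
proof -
  let ?P = "{\<pi>. \<pi> permutes V}"
  let ?h = "\<lambda>\<pi>. (`) \<pi> ` E"
  have fin: "finite ?P" using V by (rule finite_permutations)
  have fibre: "card {\<pi> \<in> ?P. ?h \<pi> = ?h \<sigma>} = card (Aut (V, E))" if \<sigma>: "\<sigma> permutes V" for \<sigma>
  proof -
    let ?\<tau> = "inv_into UNIV \<sigma>"
    have inv: "?\<tau> \<circ> \<sigma> = id" "\<sigma> \<circ> ?\<tau> = id" "?\<tau> permutes V"
      using permutes_inv_o[OF \<sigma>] permutes_inv[OF \<sigma>] by auto
    have 1: "\<forall>\<pi>\<in>Aut (V, E). ?\<tau> \<circ> (\<sigma> \<circ> \<pi>) = \<pi>"
      using inv by (simp flip: comp_assoc)
    have 2: "\<forall>\<pi>\<in>{\<pi> \<in> ?P. ?h \<pi> = ?h \<sigma>}. \<sigma> \<circ> (?\<tau> \<circ> \<pi>) = \<pi>"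
      using inv by (simp flip: comp_assoc)
    have 3: "(\<lambda>\<pi>. \<sigma> \<circ> \<pi>) ` Aut (V, E) \<subseteq> {\<pi> \<in> ?P. ?h \<pi> = ?h \<sigma>}"
    proof (rule image_subsetI)
      fix \<pi> assume "\<pi> \<in> Aut (V, E)"
      then show "\<sigma> \<circ> \<pi> \<in> {\<pi> \<in> ?P. ?h \<pi> = ?h \<sigma>}"
        using \<sigma> image_image_edges[of \<sigma> \<pi> E] by (simp add: Aut_def permutes_compose)
    qed
    have "?h (?\<tau> \<circ> \<pi>) = E" if "?h \<pi> = ?h \<sigma>" for \<pi>
    proof -
      have "?h (?\<tau> \<circ> \<pi>) = ?h (?\<tau> \<circ> \<sigma>)"
        using that image_image_edges[of ?\<tau> \<pi> E] image_image_edges[of ?\<tau> \<sigma> E] by simp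
      then show ?thesis using inv by simp
    qed
    then have 4: "(\<lambda>\<pi>. ?\<tau> \<circ> \<pi>) ` {\<pi> \<in> ?P. ?h \<pi> = ?h \<sigma>} \<subseteq> Aut (V, E)"
      using inv by (intro image_subsetI) (simp add: Aut_def permutes_compose)
    show ?thesis
      by (rule bij_betw_same_card[symmetric, OF bij_betw_byWitness[OF 1 2 3 4]])
  qed
  have "fact (card V) = card ?P" using card_permutations[OF refl V] by simp
  also have "\<dots> = (\<Sum>E'\<in>?h ` ?P. card {\<pi> \<in> ?P. ?h \<pi> = E'})"
    using sum.image_gen[OF fin, of "\<lambda>_. 1::nat" ?h] by simp
  also have "\<dots> = (\<Sum>E'\<in>?h ` ?P. card (Aut (V, E)))"
    using fibre by (intro sum.cong) auto
  also have "?h ` ?P = {(`) \<pi> ` E | \<pi>. \<pi> permutes V}" by auto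
  finally show ?thesis by simp
qed

lemma graph_iso_refl: "graph_iso G G"
  unfolding graph_iso_def by (intro exI[of _ id]) auto

lemma graph_iso_sym:
  assumes "simple_graph G" "graph_iso G H" shows "graph_iso H G"
proof -
  obtain f where f: "bij_betw f (fst G) (fst H)" "(`) f ` snd G = snd H"
    using assms(2) by (auto simp: graph_iso_def)
  have G: "snd G \<subseteq> Pow (fst G)" using assms(1) by (auto simp: simple_graph_def)
  have "(`) (inv_into (fst G) f) ` snd H = snd G"
    unfolding f(2)[symmetric] image_image_edges
    using bij_betw_imp_inj_on[OF f(1)] by (intro image_edges_id[OF G]) simp
  then show ?thesis
    using bij_betw_inv_into[OF f(1)] by (auto simp: graph_iso_def)
qed

lemma graph_iso_trans:
  assumes "graph_iso G H" "graph_iso H K" shows "graph_iso G K"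
proof -
  obtain f g where "bij_betw f (fst G) (fst H)" "(`) f ` snd G = snd H"
    "bij_betw g (fst H) (fst K)" "(`) g ` snd H = snd K"
    using assms by (auto simp: graph_iso_def)
  then have "bij_betw (g \<circ> f) (fst G) (fst K)" "(`) (g \<circ> f) ` snd G = snd K"
    using image_image_edges[of g f "snd G"] by (blast intro: bij_betw_trans, simp)
  then show ?thesis unfolding graph_iso_def by blast
qed

lemma equiv_iso_rel: "equiv {G. simple_graph G} iso_rel"
proof (rule equivI)
  show "iso_rel \<subseteq> {G. simple_graph G} \<times> {G. simple_graph G}" by (auto simp: iso_rel_def)
  show "refl_on {G. simple_graph G} iso_rel"
    by (auto simp: refl_on_def iso_rel_def graph_iso_refl)
  show "sym iso_rel" by (auto simp: sym_def iso_rel_def intro: graph_iso_sym)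
  show "trans iso_rel" by (auto simp: trans_def iso_rel_def intro: graph_iso_trans)
qed

lemma graph_iso_same_vertices_iff:
  assumes "E \<subseteq> Pow V"
  shows "graph_iso (V, E) (V, E') \<longleftrightarrow> (\<exists>\<pi>. \<pi> permutes V \<and> E' = (`) \<pi> ` E)"
proof
  assume "graph_iso (V, E) (V, E')"
  then obtain f where f: "bij_betw f V V" "(`) f ` E = E'" by (auto simp: graph_iso_def)
  let ?\<pi> = "\<lambda>x. if x \<in> V then f x else x"
  have "bij_betw ?\<pi> V V" using f(1) by (rule bij_betw_cong[THEN iffD1, rotated]) simp
  then have "?\<pi> permutes V" by (rule bij_imp_permutes) simp
  moreover have "(`) ?\<pi> ` E = (`) f ` E" by (rule image_edges_cong[OF assms]) simp
  ultimately show "\<exists>\<pi>. \<pi> permutes V \<and> E' = (`) \<pi> ` E" using f(2) by metis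
next
  assume "\<exists>\<pi>. \<pi> permutes V \<and> E' = (`) \<pi> ` E"
  then show "graph_iso (V, E) (V, E')" by (auto simp: graph_iso_def intro: permutes_imp_bij)
qed

lemma graph_term_iso:
  assumes "simple_graph G" "graph_iso G H"
  shows "graph_term H = graph_term G"
proof -
  obtain V E V' E' where G: "G = (V, E)" and H: "H = (V', E')" by (cases G, cases H)
  obtain f where f: "bij_betw f V V'" "(`) f ` E = E'"
    using assms(2) by (auto simp: graph_iso_def G H)
  have E: "finite V" "E \<subseteq> edges_on V" "E \<subseteq> Pow V"
    using assms(1) edges_on_subset_Pow by (auto simp: G simple_graph_iff)
  have V': "inj_on f V" "V' = f ` V" using f(1) by (auto simp: bij_betw_def)
  have H': "simple_graph (V', E')"
    using image_edges_on[OF V'(1) E(2)] E(1) f(2) V'(2) by (auto simp: simple_graph_iff)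
  show ?thesis
    unfolding G H graph_term_eq[OF H'] graph_term_eq[OF assms(1)[unfolded G]]
    using card_Aut_image[OF f(1) E(3)] edge_sum_image[OF V'(1) E(3)] f(2) V'(2) by metis
qed

text \<open>The edge sets of the graphs on \<open>V\<close> with property \<open>P\<close>.\<close>

definition graphs_on :: "('a graph \<Rightarrow> bool) \<Rightarrow> 'a set \<Rightarrow> 'a set set set" where
  "graphs_on P V = {E. E \<subseteq> edges_on V \<and> P (V, E)}"

lemma finite_graphs_on: "finite V \<Longrightarrow> finite (graphs_on P V)"
  unfolding graphs_on_def by (rule finite_subset[of _ "Pow (edges_on V)"]) auto

text \<open>The class of a graph \<open>G\<close> with \<open>n\<close> vertices contains \<open>n! / |Aut G|\<close> graphs on \<open>{..<n}\<close>, so that a sum over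
  classes with weight \<open>1 / |Aut G|\<close> is a sum over labelled graphs with weight \<open>1 / n!\<close>.  Only graphs with
  \<open>n\<close> vertices contribute in weighted degree \<open>n\<close>.\<close>

lemma sum_over_iso_classes:
  fixes P :: "nat graph \<Rightarrow> bool"
  assumes P: "\<And>G H. simple_graph G \<Longrightarrow> graph_iso G H \<Longrightarrow> P G \<Longrightarrow> P H"
  shows "formal_sum ({G. simple_graph G \<and> P G} // iso_rel) (\<lambda>C. graph_term (SOME G. G \<in> C)) =
    graded_series (\<lambda>n. mfps_smult (1 / fact n)
      (\<Sum>E\<in>graphs_on P {..<n}. edge_sum mfps_var (\<lambda>_. 1) (-1) {..<n} E))"
    (is "formal_sum ?Q _ = graded_series (\<lambda>n. mfps_smult _ (\<Sum>E\<in>_. ?chrom n E))")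
proof (rule mfps_eqI)
  fix m
  define n where "n = wdeg m"
  let ?rep = "\<lambda>C. SOME G. G \<in> C"
  let ?X = "graphs_on P {..<n}"
  let ?cl = "\<lambda>E. iso_rel `` {({..<n}, E)}"
  have simple: "simple_graph ({..<n}, E)" if "E \<in> ?X" for E
    using that by (auto simp: graphs_on_def simple_graph_iff)
  have finX: "finite ?X" by (rule finite_graphs_on) simp
  have rep: "simple_graph (?rep C) \<and> P (?rep C) \<and> C = iso_rel `` {?rep C}" if C: "C \<in> ?Q" for C
  proof -
    obtain G where G: "simple_graph G" "P G" "C = iso_rel `` {G}"
      using C unfolding quotient_def by blast
    then have "G \<in> C" by (simp add: iso_rel_def graph_iso_refl)
    then have "?rep C \<in> C" by (rule someI)
    then have GR: "(G, ?rep C) \<in> iso_rel" using G by simp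
    then have "iso_rel `` {G} = iso_rel `` {?rep C}"
      by (rule equiv_class_eq[OF equiv_iso_rel])
    moreover have "simple_graph (?rep C)" "graph_iso G (?rep C)"
      using GR unfolding iso_rel_def by blast+
    ultimately show ?thesis using G P[of G] by blast
  qed
  have sub: "?cl ` ?X \<subseteq> ?Q"
    using simple by (auto simp: graphs_on_def intro!: quotientI)
  \<comment> \<open>Classes without a representative on \<open>{..<n}\<close> have a number of vertices other than \<open>n\<close>.\<close>
  have zero: "mfps_nth (graph_term (?rep C)) m = 0" if C: "C \<in> ?Q - ?cl ` ?X" for C
  proof -
    obtain V F where VF: "?rep C = (V, F)" by (cases "?rep C")
    then have VF': "simple_graph (V, F)" "P (V, F)" "C = iso_rel `` {(V, F)}"
      using rep[of C, unfolded VF] C by blast+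
    then have fin: "finite V" "F \<subseteq> edges_on V" by (auto simp: simple_graph_iff)
    have "card V \<noteq> n"
    proof
      assume "card V = n"
      then obtain h where h: "bij_betw h V {..<n}"
        using ex_bij_betw_finite_nat[OF fin(1)] by (auto simp: atLeast0LessThan)
      let ?E = "(`) h ` F"
      have iso: "graph_iso (V, F) ({..<n}, ?E)" using h by (auto simp: graph_iso_def)
      have "?E \<subseteq> edges_on {..<n}"
        using image_edges_on[OF _ fin(2), of h] h by (simp add: bij_betw_def)
      then have E: "?E \<in> ?X" using P[OF VF'(1) iso VF'(2)] by (simp add: graphs_on_def)
      have "((V, F), ({..<n}, ?E)) \<in> iso_rel"
        using VF' iso simple[OF E] by (simp add: iso_rel_def)
      then have "C = ?cl ?E" unfolding VF'(3) by (rule equiv_class_eq[OF equiv_iso_rel])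
      then show False using E C by blast
    qed
    moreover have "homogeneous (card V) (graph_term (V, F))"
      unfolding graph_term_eq[OF VF'(1)]
      using fin edges_on_subset_Pow[of V]
      by (intro homogeneous_smult homogeneous_edge_sum homogeneous_uminus homogeneous_1) auto
    ultimately show ?thesis unfolding VF n_def homogeneous_def by metis
  qed
  \<comment> \<open>The members of \<open>?X\<close> in a given class form an orbit of the permutations.\<close>
  have class_sum: "mfps_nth (graph_term (?rep C)) m =
      (\<Sum>E | E \<in> ?X \<and> ?cl E = C. mfps_nth (?chrom n E) m / fact n)" if C: "C \<in> ?cl ` ?X" for C
  proof -
    obtain E where E: "E \<in> ?X" "C = ?cl E" using C by auto
    have E': "E \<subseteq> Pow {..<n}" "E \<subseteq> edges_on {..<n}" "P ({..<n}, E)"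
      using E edges_on_subset_Pow[of "{..<n}"] by (auto simp: graphs_on_def)
    have "({..<n}, E) \<in> C"
      unfolding E(2) using simple[OF E(1)] by (simp add: iso_rel_def graph_iso_refl)
    then have "?rep C \<in> C" by (rule someI)
    moreover have "graph_iso ({..<n}, E) H" if "H \<in> C" for H
      using that by (simp add: E(2) iso_rel_def)
    ultimately have "graph_iso ({..<n}, E) (?rep C)" by blast
    then have rep_term: "graph_term (?rep C) = graph_term ({..<n}, E)"
      by (rule graph_term_iso[OF simple[OF E(1)]])
    have iso_iff: "E1 \<in> ?X \<and> ?cl E1 = C \<longleftrightarrow> (\<exists>\<pi>. \<pi> permutes {..<n} \<and> E1 = (`) \<pi> ` E)" for E1
    proof
      assume E1: "E1 \<in> ?X \<and> ?cl E1 = C"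
      then have "(({..<n}, E), ({..<n}, E1)) \<in> iso_rel"
        using eq_equiv_class[OF _ equiv_iso_rel, of "({..<n}, E)" "({..<n}, E1)"] simple
        by (simp add: E)
      then show "\<exists>\<pi>. \<pi> permutes {..<n} \<and> E1 = (`) \<pi> ` E"
        using graph_iso_same_vertices_iff[OF E'(1)] by (simp add: iso_rel_def)
    next
      assume "\<exists>\<pi>. \<pi> permutes {..<n} \<and> E1 = (`) \<pi> ` E"
      then obtain \<pi> where \<pi>: "\<pi> permutes {..<n}" "E1 = (`) \<pi> ` E" by blast
      then have iso: "graph_iso ({..<n}, E) ({..<n}, E1)"
        using graph_iso_same_vertices_iff[OF E'(1)] by blast
      have "E1 \<subseteq> edges_on {..<n}"
        using image_edges_on[OF permutes_inj_on[OF \<pi>(1)] E'(2)] permutes_image[OF \<pi>(1)] \<pi>(2) by simp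
      then have E1: "E1 \<in> ?X" using P[OF simple[OF E(1)] iso E'(3)] by (simp add: graphs_on_def)
      have "(({..<n}, E), ({..<n}, E1)) \<in> iso_rel"
        using iso simple E(1) E1 by (simp add: iso_rel_def)
      then show "E1 \<in> ?X \<and> ?cl E1 = C"
        using E1 equiv_class_eq[OF equiv_iso_rel] by (simp add: E)
    qed
    have "?chrom n E1 = ?chrom n E" if E1: "E1 \<in> ?X \<and> ?cl E1 = C" for E1
    proof -
      obtain \<pi> where \<pi>: "\<pi> permutes {..<n}" "E1 = (`) \<pi> ` E"
        using E1 unfolding iso_iff by blast
      show ?thesis
        using edge_sum_image[OF permutes_inj_on[OF \<pi>(1)] E'(1), of mfps_var "-1"]
        unfolding permutes_image[OF \<pi>(1)] \<pi>(2)[symmetric] .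
    qed
    then have "(\<Sum>E1 | E1 \<in> ?X \<and> ?cl E1 = C. mfps_nth (?chrom n E1) m / fact n) =
        (\<Sum>E1 | E1 \<in> ?X \<and> ?cl E1 = C. mfps_nth (?chrom n E) m / fact n)"
      by (intro sum.cong) auto
    also have "\<dots> = of_nat (card {(`) \<pi> ` E | \<pi>. \<pi> permutes {..<n}}) * (mfps_nth (?chrom n E) m / fact n)"
      unfolding iso_iff by (simp add: conj_commute)
    also have "\<dots> = mfps_nth (graph_term ({..<n}, E)) m"
    proof -
      have "fact n = card {(`) \<pi> ` E | \<pi>. \<pi> permutes {..<n}} * card (Aut ({..<n}, E))"
        using fact_eq_card_orbit_Aut[OF _ E'(1)] by simp
      then have "of_nat (fact n) = (of_nat (card {(`) \<pi> ` E | \<pi>. \<pi> permutes {..<n}} *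
          card (Aut ({..<n}, E))) :: complex)"
        by (rule arg_cong)
      then have "(fact n :: complex) =
          of_nat (card {(`) \<pi> ` E | \<pi>. \<pi> permutes {..<n}}) * of_nat (card (Aut ({..<n}, E)))"
        by (simp only: of_nat_fact of_nat_mult)
      moreover have "(fact n :: complex) \<noteq> 0" by simp
      ultimately show ?thesis
        unfolding graph_term_eq[OF simple[OF E(1)]] by (simp add: field_simps)
    qed
    finally show ?thesis by (simp add: rep_term)
  qed
  have "mfps_nth (formal_sum ?Q (\<lambda>C. graph_term (?rep C))) m =
      (\<Sum>C\<in>?cl ` ?X. mfps_nth (graph_term (?rep C)) m)"
    using finX sub zero by (intro mfps_nth_formal_sum_finite) auto
  also have "\<dots> = (\<Sum>C\<in>?cl ` ?X. \<Sum>E | E \<in> ?X \<and> ?cl E = C. mfps_nth (?chrom n E) m / fact n)"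
    by (intro sum.cong refl class_sum)
  also have "\<dots> = (\<Sum>E\<in>?X. mfps_nth (?chrom n E) m / fact n)"
    by (rule sum.image_gen[OF finX, symmetric])
  finally show "mfps_nth (formal_sum ?Q (\<lambda>C. graph_term (?rep C))) m =
      mfps_nth (graded_series (\<lambda>n. mfps_smult (1 / fact n) (\<Sum>E\<in>graphs_on P {..<n}. ?chrom n E))) m"
    by (simp add: mfps_nth_sum sum_divide_distrib n_def)
qed

lemma sum_graphs_on_bij:
  fixes g :: "'a set \<Rightarrow> 'a set set \<Rightarrow> 'r::comm_monoid_add"
  assumes h: "bij_betw h V V'"
    and P: "\<And>f V E. inj_on f V \<Longrightarrow> E \<subseteq> Pow V \<Longrightarrow> P (V, E) \<Longrightarrow> P (f ` V, (`) f ` E)"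
    and g: "\<And>f V E. inj_on f V \<Longrightarrow> E \<subseteq> Pow V \<Longrightarrow> g (f ` V) ((`) f ` E) = g V E"
  shows "(\<Sum>E\<in>graphs_on P V. g V E) = (\<Sum>E\<in>graphs_on P V'. g V' E)"
proof -
  have image: "(`) h ` E \<in> graphs_on P V'" if "bij_betw h V V'" "E \<in> graphs_on P V" for h V V' E
    using that P[of h V E] image_edges_on[of h V E] edges_on_subset_Pow[of V]
    by (auto simp: graphs_on_def bij_betw_def)
  have inv: "(`) (inv_into V h) ` (`) h ` E = E" if "bij_betw h V V'" "E \<in> graphs_on P V" for h V V' E
    unfolding image_image_edges
    using that edges_on_subset_Pow[of V]
    by (intro image_edges_id[of E V]) (auto simp: graphs_on_def bij_betw_def)
  have inv': "(`) h ` (`) (inv_into V h) ` E = E" if "E \<in> graphs_on P V'" for E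
    unfolding image_image_edges
    using that edges_on_subset_Pow[of V'] h
    by (intro image_edges_id[of E V']) (auto simp: graphs_on_def bij_betw_inv_into_right)
  show ?thesis
  proof (rule sum.reindex_bij_witness[of _ "(`) ((`) (inv_into V h))" "(`) ((`) h)"])
    fix E assume E: "E \<in> graphs_on P V"
    show "(`) (inv_into V h) ` (`) h ` E = E" "(`) h ` E \<in> graphs_on P V'"
      using inv[OF h E] image[OF h E] by auto
    show "g V' ((`) h ` E) = g V E"
      using g[of h V E] h E edges_on_subset_Pow[of V] by (auto simp: graphs_on_def bij_betw_def)
  next
    fix E assume E: "E \<in> graphs_on P V'"
    show "(`) h ` (`) (inv_into V h) ` E = E" "(`) (inv_into V h) ` E \<in> graphs_on P V"
      using inv'[OF E] image[OF bij_betw_inv_into[OF h] E] by auto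
  qed
qed

section \<open>Binomial recursions and the exponential\<close>

text \<open>The recursion is the equation \<open>euler T = euler F * T\<close> in degree \<open>n\<close>, for \<open>F = \<Sum> y\<^sub>n / n!\<close> and
  \<open>T = \<Sum> x\<^sub>n / n!\<close>.\<close>

lemma exp_graded:
  assumes x: "\<And>n. homogeneous n (x n)" "x 0 = 1"
    and y: "\<And>n. homogeneous n (y n)" "y 0 = 0"
    and rec: "\<And>n. n \<ge> 1 \<Longrightarrow>
      x n = (\<Sum>k=1..n. of_nat ((n - 1) choose (k - 1)) * (y k * x (n - k)))"
  shows "mfps_exp (graded_series (\<lambda>n. mfps_smult (1 / fact n) (y n))) =
         graded_series (\<lambda>n. mfps_smult (1 / fact n) (x n))"
proof -
  let ?F = "graded_series (\<lambda>n. mfps_smult (1 / fact n) (y n))"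
  let ?T = "graded_series (\<lambda>n. mfps_smult (1 / fact n) (x n))"
  have F: "order_ge 1 ?F" using y(2) by (simp add: order_ge_def)
  have euler_F: "euler ?F = graded_series (\<lambda>n. mfps_smult (of_nat n / fact n) (y n))"
    by (rule mfps_eqI) simp
  have "euler ?T = euler ?F * ?T"
  proof (rule mfps_eqI)
    fix m
    let ?n = "wdeg m"
    have coeff: "of_nat ?n / fact ?n * of_nat ((?n - 1) choose (k - 1)) =
        of_nat k / fact k * (1 / fact (?n - k) :: complex)" if k: "k \<in> {1..?n}" for k
    proof -
      obtain j where j: "k = Suc j" using k by (cases k) auto
      obtain l where l: "?n = Suc l" using k by (cases ?n) auto
      have "j \<le> l" using k j l by simp
      then have "(of_nat (l choose j) :: complex) = fact l / (fact j * fact (l - j))"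
        by (rule binomial_fact)
      moreover have "of_nat (Suc i) / fact (Suc i) = (1 / fact i :: complex)" for i
        by (simp del: of_nat_Suc)
      ultimately show ?thesis unfolding j l by simp
    qed
    have "mfps_nth (euler ?T) m = of_nat ?n / fact ?n * mfps_nth (x ?n) m" by simp
    also have "\<dots> = (\<Sum>k=1..?n. of_nat k / fact k * (1 / fact (?n - k)) * mfps_nth (y k * x (?n - k)) m)"
    proof (cases "?n = 0")
      case False
      then have "mfps_nth (x ?n) m =
          (\<Sum>k=1..?n. of_nat ((?n - 1) choose (k - 1)) * mfps_nth (y k * x (?n - k)) m)"
        by (subst rec) (simp_all add: mfps_nth_sum of_nat_mfps_mult)
      then show ?thesis
        using coeff by (simp add: sum_distrib_left mult.assoc[symmetric])
    qed simp
    also have "\<dots> = (\<Sum>k\<le>?n. of_nat k / fact k * (1 / fact (?n - k)) * mfps_nth (y k * x (?n - k)) m)"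
      by (intro sum.mono_neutral_left) (auto simp: not_le)
    also have "\<dots> = mfps_nth (euler ?F * ?T) m"
      unfolding euler_F
      by (subst mfps_nth_graded_mult)
        (auto intro!: homogeneous_smult x y simp: mfps_smult_mult mult_mfps_smult mult.commute)
    finally show "mfps_nth (euler ?T) m = mfps_nth (euler ?F * ?T) m" .
  qed
  moreover have "order_ge 1 (euler ?F)" by (simp add: order_ge_def)
  moreover have "mfps_nth (mfps_exp ?F) m = mfps_nth ?T m" if "wdeg m = 0" for m
    using mfps_nth_exp_degree_0[OF F that] x(2) that by simp
  ultimately show ?thesis
    by (intro euler_equation_unique[OF _ euler_exp[OF F]])
qed

section \<open>The exponential formula for graphs\<close>

lemma sum_over_component_edge_sum:
  assumes V: "finite V" "v \<in> V"
  shows "(\<Sum>E\<in>Pow (edges_on V). edge_sum q w y V E) =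
    (\<Sum>S | S \<subseteq> V \<and> v \<in> S. (\<Sum>E\<in>connected_on S. edge_sum q w y S E) *
       (\<Sum>E\<in>Pow (edges_on (V - S)). edge_sum q w y (V - S) E))"
  unfolding sum_over_component[OF V] sum_product
proof (intro sum.cong refl)
  fix S E1 E2
  assume S: "S \<in> {S. S \<subseteq> V \<and> v \<in> S}" and E: "E1 \<in> connected_on S" "E2 \<in> Pow (edges_on (V - S))"
  then have "S \<union> (V - S) = V" "finite S" "finite (V - S)"
    using V finite_subset[of S V] by auto
  then show "edge_sum q w y V (E1 \<union> E2) = edge_sum q w y S E1 * edge_sum q w y (V - S) E2"
    using edge_sum_disjoint_Un[of S "V - S" E1 E2 q w y] E by (simp add: connected_on_def)
qed

text \<open>The sums of the weighted chromatic polynomials of all graphs and of all connected graphs with vertex set \<open>V\<close>.\<close>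

definition chrom_sum :: "nat set \<Rightarrow> mfps" where
  "chrom_sum V = (\<Sum>E\<in>Pow (edges_on V). edge_sum mfps_var (\<lambda>_. 1) (-1) V E)"

definition chrom_conn_sum :: "nat set \<Rightarrow> mfps" where
  "chrom_conn_sum V = (\<Sum>E\<in>connected_on V. edge_sum mfps_var (\<lambda>_. 1) (-1) V E)"

lemma graph_iso_connected:
  assumes "simple_graph G" "graph_iso G H" "connected_graph G"
  shows "connected_graph H"
proof -
  obtain f where f: "bij_betw f (fst G) (fst H)" "(`) f ` snd G = snd H"
    using assms(2) by (auto simp: graph_iso_def)
  have "snd G \<subseteq> Pow (fst G)" using assms(1) by (auto simp: simple_graph_def)
  then have "connected_graph (f ` fst G, (`) f ` snd G)"
    using f(1) assms(3) by (intro connected_graph_image) (auto simp: bij_betw_def)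
  moreover have "f ` fst G = fst H" using f(1) by (simp add: bij_betw_def)
  ultimately show ?thesis using f(2) by simp
qed

lemma graphs_on_True: "graphs_on (\<lambda>_. True) V = Pow (edges_on V)"
  by (auto simp: graphs_on_def)

lemma graphs_on_connected: "graphs_on connected_graph V = connected_on V"
  by (auto simp: graphs_on_def connected_on_def)

lemma connected_on_subset: "connected_on V \<subseteq> Pow (edges_on V)"
  by (auto simp: connected_on_def)

lemma W_all_eq: "W_all = graded_series (\<lambda>n. mfps_smult (1 / fact n) (chrom_sum {..<n}))"
  using sum_over_iso_classes[of "\<lambda>_. True"]
  by (simp add: W_all_def graph_classes_def chrom_sum_def graphs_on_True)

lemma W_connected_eq:
  "W_connected = graded_series (\<lambda>n. mfps_smult (1 / fact n) (chrom_conn_sum {..<n}))"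
  unfolding W_connected_def connected_graph_classes_def chrom_conn_sum_def graphs_on_connected[symmetric]
  by (rule sum_over_iso_classes) (rule graph_iso_connected)

lemma homogeneous_chrom:
  assumes "finite V" "X \<subseteq> Pow (edges_on V)"
  shows "homogeneous (card V) (\<Sum>E\<in>X. edge_sum mfps_var (\<lambda>_. 1) (-1) V E)"
proof (rule homogeneous_sum)
  fix E assume "E \<in> X"
  then have "E \<subseteq> Pow V" using assms(2) edges_on_subset_Pow by blast
  then show "homogeneous (card V) (edge_sum mfps_var (\<lambda>_. 1) (-1) V E)"
    by (intro homogeneous_edge_sum assms homogeneous_uminus homogeneous_1)
qed

lemma chrom_conn_sum_card:
  assumes "finite V" shows "chrom_conn_sum V = chrom_conn_sum {..<card V}"
proof -
  obtain h where "bij_betw h V {..<card V}"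
    using ex_bij_betw_finite_nat[OF assms] by (auto simp: atLeast0LessThan)
  then show ?thesis
    unfolding chrom_conn_sum_def graphs_on_connected[symmetric]
    by (rule sum_graphs_on_bij) ((rule connected_graph_image | rule edge_sum_image); assumption)+
qed

lemma chrom_sum_recursion:
  assumes "finite V" "v \<in> V"
  shows "chrom_sum V =
    (\<Sum>S | S \<subseteq> V \<and> v \<in> S. chrom_conn_sum {..<card S} * chrom_sum (V - S))"
  unfolding chrom_sum_def sum_over_component_edge_sum[OF assms]
proof (intro sum.cong refl arg_cong2[of _ _ _ _ "(*)"])
  fix S assume "S \<in> {S. S \<subseteq> V \<and> v \<in> S}"
  then have S: "finite S" using assms finite_subset[of S V] by auto
  show "(\<Sum>E\<in>connected_on S. edge_sum mfps_var (\<lambda>_. 1) (-1) S E) = chrom_conn_sum {..<card S}"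
    using chrom_conn_sum_card[OF S] unfolding chrom_conn_sum_def .
qed

text \<open>A function of finite sets that satisfies a recursion over the subsets containing a given
  element depends on the cardinality only.\<close>

lemma card_recursion_lessThan:
  fixes f :: "nat set \<Rightarrow> 'r::comm_ring_1"
  assumes rec: "\<And>V v. finite V \<Longrightarrow> v \<in> V \<Longrightarrow>
      f V = (\<Sum>S | S \<subseteq> V \<and> v \<in> S. y (card S) * f (V - S))"
    and n: "n \<ge> 1"
  shows "f {..<n} = (\<Sum>k=1..n. of_nat ((n - 1) choose (k - 1)) * (y k * f {..<n - k}))"
proof -
  have *: "f V = f {..<card V}" if "finite V" for V
    using that
  proof (induction "card V" arbitrary: V rule: less_induct)
    case less
    show ?case
    proof (cases "V = {}")
      case False
      then obtain v where v: "v \<in> V" by blast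
      have step: "f U = (\<Sum>k=1..card U. of_nat ((card U - 1) choose (k - 1)) * (y k * f {..<card U - k}))"
        if U: "finite U" "u \<in> U" "card U = card V" for U u
      proof -
        have "f U = (\<Sum>S | S \<subseteq> U \<and> u \<in> S. y (card S) * f {..<card U - card S})"
          unfolding rec[OF U(1,2)]
        proof (intro sum.cong refl)
          fix S assume "S \<in> {S. S \<subseteq> U \<and> u \<in> S}"
          then have S: "S \<subseteq> U" "u \<in> S" "finite S" using U finite_subset[of S U] by auto
          then have "card (U - S) < card V"
            unfolding U(3)[symmetric] using U by (intro psubset_card_mono) auto
          then have "f (U - S) = f {..<card (U - S)}"
            by (rule less.hyps) (use U in simp)
          then show "y (card S) * f (U - S) = y (card S) * f {..<card U - card S}"
            using S by (simp add: card_Diff_subset)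
        qed
        then show ?thesis
          using sum_subsets_containing[OF U(1,2), of "\<lambda>k. y k * f {..<card U - k}"] by simp
      qed
      have "0 \<in> {..<card V}" using v less.prems by (simp add: card_gt_0_iff) blast
      then show ?thesis using step[OF less.prems v] step[of "{..<card V}" 0] by simp
    qed simp
  qed
  have "f {..<n} = (\<Sum>S | S \<subseteq> {..<n} \<and> 0 \<in> S. y (card S) * f ({..<n} - S))"
    using n by (intro rec) auto
  also have "\<dots> = (\<Sum>S | S \<subseteq> {..<n} \<and> 0 \<in> S. y (card S) * f {..<n - card S})"
  proof (intro sum.cong refl)
    fix S assume "S \<in> {S. S \<subseteq> {..<n} \<and> 0 \<in> S}"
    then have S: "S \<subseteq> {..<n}" "finite S" using finite_subset[of S "{..<n}"] by auto
    then show "y (card S) * f ({..<n} - S) = y (card S) * f {..<n - card S}"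
      using *[of "{..<n} - S"] by (simp add: card_Diff_subset)
  qed
  also have "\<dots> = (\<Sum>k=1..n. of_nat ((n - 1) choose (k - 1)) * (y k * f {..<n - k}))"
    using sum_subsets_containing[of "{..<n}" 0 "\<lambda>k. y k * f {..<n - k}"] n by simp
  finally show ?thesis .
qed

lemma edges_on_empty [simp]: "edges_on {} = {}"
  by (auto simp: edges_on_def)

lemma chrom_conn_sum_empty: "chrom_conn_sum {} = 0"
  by (simp add: chrom_conn_sum_def connected_on_def connected_graph_def)

lemma exp_W_connected: "mfps_exp W_connected = W_all"
  unfolding W_all_eq W_connected_eq
proof (rule exp_graded)
  fix n
  show "homogeneous n (chrom_sum {..<n})" "homogeneous n (chrom_conn_sum {..<n})"
    using homogeneous_chrom[OF _ order_refl, of "{..<n}"]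
      homogeneous_chrom[OF _ connected_on_subset, of "{..<n}"]
    by (simp_all add: chrom_sum_def chrom_conn_sum_def)
  show "chrom_sum {..<0} = 1"
    by (simp add: chrom_sum_def edge_sum_no_edges)
  show "chrom_conn_sum {..<0} = 0"
    by (simp add: chrom_conn_sum_empty)
  assume n: "n \<ge> 1"
  show "chrom_sum {..<n} = (\<Sum>k=1..n. of_nat ((n - 1) choose (k - 1)) *
      (chrom_conn_sum {..<k} * chrom_sum {..<n - k}))"
    using chrom_sum_recursion n
    by (rule card_recursion_lessThan[of chrom_sum "\<lambda>k. chrom_conn_sum {..<k}"])
qed

lemma order_ge_W_connected: "order_ge 1 W_connected"
  by (simp add: order_ge_def W_connected_eq chrom_conn_sum_empty)

section \<open>The sum over all labelled graphs\<close>

lemma card_supersets: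
  assumes "finite P" "F \<subseteq> P"
  shows "card {E. E \<subseteq> P \<and> F \<subseteq> E} = 2 ^ (card P - card F)"
proof -
  have "bij_betw (\<lambda>E. E - F) {E. E \<subseteq> P \<and> F \<subseteq> E} (Pow (P - F))"
    by (rule bij_betw_byWitness[of _ "\<lambda>E. E \<union> F"]) (use assms in auto)
  then have "card {E. E \<subseteq> P \<and> F \<subseteq> E} = card (Pow (P - F))" by (rule bij_betw_same_card)
  also have "\<dots> = 2 ^ (card P - card F)"
    using assms finite_subset[OF assms(2)] by (simp add: card_Pow card_Diff_subset)
  finally show ?thesis .
qed

text \<open>The constant series \<open>1/2\<close>.\<close>

definition half :: mfps where "half = mfps_smult (1 / 2) 1"

lemma uminus_half_power: "(- half) ^ n = mfps_smult ((-1 / 2) ^ n) 1"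
  by (induction n) (auto intro!: mfps_eqI simp: half_def mfps_smult_mult mult_mfps_smult)

text \<open>Exchange the summations over the graph \<open>E\<close> and the edge subset \<open>F \<subseteq> E\<close>: of the \<open>N\<close> possible edges, the
  \<open>N - |F|\<close> edges outside \<open>F\<close> are free, and \<open>2\<^bsup>N - |F|\<^esup> (-1)\<^bsup>|F|\<^esup> = 2\<^sup>N (-1/2)\<^bsup>|F|\<^esup>\<close>.\<close>

lemma chrom_sum_eq:
  assumes V: "finite V"
  shows "chrom_sum V = mfps_smult (2 ^ (card V choose 2)) (edge_sum mfps_var (\<lambda>_. 1) (- half) V (edges_on V))"
proof -
  let ?P = "edges_on V"
  let ?g = "\<lambda>F. \<Prod>C\<in>components V F. - mfps_var (sum (\<lambda>_. 1) C)"
  have fin: "finite ?P" using V by simp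
  have "(\<Sum>E\<in>Pow ?P. \<Sum>F\<in>Pow E. (-1) ^ card F * ?g F) =
      (\<Sum>E\<in>Pow ?P. \<Sum>F | F \<in> Pow ?P \<and> F \<subseteq> E. (-1) ^ card F * ?g F)"
    by (intro sum.cong) auto
  also have "\<dots> = (\<Sum>F\<in>Pow ?P. \<Sum>E | E \<in> Pow ?P \<and> F \<subseteq> E. (-1) ^ card F * ?g F)"
    using fin by (intro sum.swap_restrict) auto
  also have "\<dots> = (\<Sum>F\<in>Pow ?P. mfps_smult (2 ^ card ?P) ((- half) ^ card F * ?g F))"
  proof (intro sum.cong refl)
    fix F assume F: "F \<in> Pow ?P"
    then have le: "card F \<le> card ?P" using fin by (intro card_mono) auto
    have neg: "(-1) ^ card F = mfps_smult ((-1) ^ card F) 1"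
      using uminus_power_mfps[of 1 "card F"] by simp
    have "(\<Sum>E | E \<in> Pow ?P \<and> F \<subseteq> E. (-1) ^ card F * ?g F) =
        of_nat (2 ^ (card ?P - card F)) * ((-1) ^ card F * ?g F)"
      using card_supersets[OF fin, of F] F by simp
    also have "\<dots> = mfps_smult (2 ^ (card ?P - card F) * (-1) ^ card F) (?g F)"
      unfolding of_nat_mfps_mult neg mfps_smult_mult mfps_smult_smult by simp
    also have "(2 ^ (card ?P - card F) * (-1) ^ card F :: complex) = 2 ^ card ?P * (-1 / 2) ^ card F"
      by (subst power_divide) (simp add: power_diff le)
    finally show "(\<Sum>E | E \<in> Pow ?P \<and> F \<subseteq> E. (-1) ^ card F * ?g F) =
        mfps_smult (2 ^ card ?P) ((- half) ^ card F * ?g F)"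
      unfolding uminus_half_power mfps_smult_mult mfps_smult_smult by simp
  qed
  finally have "(\<Sum>E\<in>Pow ?P. \<Sum>F\<in>Pow E. (-1) ^ card F * ?g F) =
      mfps_smult (2 ^ card ?P) (\<Sum>F\<in>Pow ?P. (- half) ^ card F * ?g F)"
    by (simp only: mfps_smult_sum)
  then show ?thesis
    unfolding chrom_sum_def edge_sum_def sum_distrib_left[symmetric]
    by (simp only: mult_mfps_smult card_edges_on[OF V])
qed

lemma edge_sum_complete_recursion:
  assumes V: "finite V" "v \<in> V"
  shows "edge_sum q (\<lambda>_. 1) y V (edges_on V) =
    (\<Sum>S | S \<subseteq> V \<and> v \<in> S. ((-1) ^ card S * - q (card S) * (\<Sum>E\<in>connected_on S. y ^ card E)) *
       edge_sum q (\<lambda>_. 1) y (V - S) (edges_on (V - S)))"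
proof -
  let ?g = "\<lambda>V F. \<Prod>C\<in>components V F. - q (sum (\<lambda>_. 1) C)"
  let ?A = "{S. S \<subseteq> V \<and> v \<in> S}"
  have "edge_sum q (\<lambda>_. 1) y V (edges_on V) = (\<Sum>S\<in>?A. (-1) ^ card V *
      (\<Sum>E1\<in>connected_on S. \<Sum>E2\<in>Pow (edges_on (V - S)). y ^ card (E1 \<union> E2) * ?g V (E1 \<union> E2)))"
    unfolding edge_sum_def sum_over_component[OF V] by (rule sum_distrib_left)
  also have "\<dots> = (\<Sum>S\<in>?A. ((-1) ^ card S * - q (card S) * (\<Sum>E\<in>connected_on S. y ^ card E)) *
       edge_sum q (\<lambda>_. 1) y (V - S) (edges_on (V - S)))"
  proof (intro sum.cong refl)
    fix S assume "S \<in> ?A"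
    then have S: "S \<subseteq> V" "S \<union> (V - S) = V" "finite S" "finite (V - S)" "S \<inter> (V - S) = {}"
      using V finite_subset[of S V] by auto
    have cV: "card V = card S + card (V - S)"
      using card_Un_disjoint[OF S(3,4,5)] S(2) by simp
    have "y ^ card (E1 \<union> E2) * ?g V (E1 \<union> E2) =
        - q (card S) * (y ^ card E1 * (y ^ card E2 * ?g (V - S) E2))"
      if E: "E1 \<in> connected_on S" "E2 \<in> Pow (edges_on (V - S))" for E1 E2
    proof -
      have E': "E1 \<subseteq> edges_on S" "E2 \<subseteq> edges_on (V - S)" "connected_graph (S, E1)"
        using E by (auto simp: connected_on_def)
      then have P: "E1 \<subseteq> Pow S" "E2 \<subseteq> Pow (V - S)" using edges_on_subset_Pow by blast+
      have "?g V (E1 \<union> E2) = ?g S E1 * ?g (V - S) E2"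
        using prod_components_disjoint_Un[OF S(5,3,4) P] S(2) by simp
      also have "?g S E1 = - q (card S)" using components_connected[OF P(1) E'(3)] by simp
      finally have g: "?g V (E1 \<union> E2) = - q (card S) * ?g (V - S) E2" .
      show ?thesis
        unfolding g card_Un_edges[OF S(5,3,4) E'(1,2)] by (simp add: power_add algebra_simps)
    qed
    then have "(\<Sum>E1\<in>connected_on S. \<Sum>E2\<in>Pow (edges_on (V - S)). y ^ card (E1 \<union> E2) * ?g V (E1 \<union> E2)) =
        (\<Sum>E1\<in>connected_on S. \<Sum>E2\<in>Pow (edges_on (V - S)).
          - q (card S) * (y ^ card E1 * (y ^ card E2 * ?g (V - S) E2)))"
      by (intro sum.cong refl)
    also have "\<dots> = - q (card S) * ((\<Sum>E\<in>connected_on S. y ^ card E) *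
        (\<Sum>E\<in>Pow (edges_on (V - S)). y ^ card E * ?g (V - S) E))"
      by (subst sum_product) (simp only: sum_distrib_left)
    finally have inner: "(\<Sum>E1\<in>connected_on S. \<Sum>E2\<in>Pow (edges_on (V - S)). y ^ card (E1 \<union> E2) * ?g V (E1 \<union> E2)) =
      - q (card S) * ((\<Sum>E\<in>connected_on S. y ^ card E) *
        (\<Sum>E\<in>Pow (edges_on (V - S)). y ^ card E * ?g (V - S) E))" .
    show "(-1) ^ card V * (\<Sum>E1\<in>connected_on S. \<Sum>E2\<in>Pow (edges_on (V - S)).
          y ^ card (E1 \<union> E2) * ?g V (E1 \<union> E2)) =
        ((-1) ^ card S * - q (card S) * (\<Sum>E\<in>connected_on S. y ^ card E)) *
          edge_sum q (\<lambda>_. 1) y (V - S) (edges_on (V - S))"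
      unfolding inner cV power_add edge_sum_def by (simp only: ac_simps)
  qed
  finally show ?thesis .
qed

lemma sum_power_card_graphs:
  fixes y :: "'r::comm_ring_1"
  assumes V: "finite V" "v \<in> V"
  shows "(1 + y) ^ (card V choose 2) =
    (\<Sum>S | S \<subseteq> V \<and> v \<in> S. (\<Sum>E\<in>connected_on S. y ^ card E) * (1 + y) ^ ((card V - card S) choose 2))"
proof -
  have "(1 + y) ^ (card V choose 2) = (\<Sum>E\<in>Pow (edges_on V). y ^ card E)"
    using sum_power_card[OF finite_edges_on[OF V(1)], of y] by (simp add: card_edges_on[OF V(1)])
  also have "\<dots> = (\<Sum>S | S \<subseteq> V \<and> v \<in> S. (\<Sum>E\<in>connected_on S. y ^ card E) *
      (\<Sum>E\<in>Pow (edges_on (V - S)). y ^ card E))"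
    unfolding sum_over_component[OF V] sum_product
  proof (intro sum.cong refl)
    fix S E1 E2
    assume S: "S \<in> {S. S \<subseteq> V \<and> v \<in> S}" and E: "E1 \<in> connected_on S" "E2 \<in> Pow (edges_on (V - S))"
    have "finite S" "finite (V - S)" using S V finite_subset[of S V] by auto
    then show "y ^ card (E1 \<union> E2) = y ^ card E1 * y ^ card E2"
      using card_Un_edges[of S "V - S" E1 E2] E by (simp add: connected_on_def power_add)
  qed
  also have "\<dots> = (\<Sum>S | S \<subseteq> V \<and> v \<in> S. (\<Sum>E\<in>connected_on S. y ^ card E) *
      (1 + y) ^ ((card V - card S) choose 2))"
  proof (intro sum.cong refl)
    fix S assume "S \<in> {S. S \<subseteq> V \<and> v \<in> S}"
    then have S: "S \<subseteq> V" "finite S" "finite (V - S)" using V finite_subset[of S V] by auto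
    show "(\<Sum>E\<in>connected_on S. y ^ card E) * (\<Sum>E\<in>Pow (edges_on (V - S)). y ^ card E) =
        (\<Sum>E\<in>connected_on S. y ^ card E) * (1 + y) ^ ((card V - card S) choose 2)"
      using sum_power_card[OF finite_edges_on[OF S(3)], of y] card_edges_on[OF S(3)] S
      by (simp add: card_Diff_subset)
  qed
  finally show ?thesis .
qed

section \<open>The rescaling constants\<close>

lemma choose_two_add: "(k + l) choose 2 = (k choose 2) + (l choose 2) + k * l"
proof (induction k)
  case (Suc k)
  have "Suc n choose 2 = (n choose 2) + n" for n by (simp add: numeral_2_eq_2)
  then show ?case using Suc by simp
qed simp

text \<open>The sequence of denominators in the substitution.\<close>

definition rescaling_recursion :: "(nat \<Rightarrow> int) \<Rightarrow> bool" where
  "rescaling_recursion c \<longleftrightarrow> c 1 = 1 \<and> (\<forall>n\<ge>2. c n = (-1) ^ (n + 1) *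
     (1 + (\<Sum>k = 1..n - 1. (-1) ^ k * 2 ^ (k * (n - k)) * int ((n - 1) choose (k - 1)) * c k)))"

text \<open>Every power \<open>2\<^bsup>k (n - k)\<^esup>\<close> in the recursion is even, hence all \<open>c n\<close> are odd.\<close>

lemma rescaling_recursion_nonzero:
  assumes c: "rescaling_recursion c" and n: "n \<ge> 1"
  shows "c n \<noteq> 0"
proof (cases "n = 1")
  case True
  then show ?thesis using c by (simp add: rescaling_recursion_def)
next
  case False
  let ?s = "\<Sum>k = 1..n - 1. (-1) ^ k * 2 ^ (k * (n - k)) * int ((n - 1) choose (k - 1)) * c k"
  have "even ?s"
  proof (rule dvd_sum)
    fix k assume "k \<in> {1..n - 1}"
    then have "k * (n - k) \<noteq> 0" by auto
    then have "even ((2::int) ^ (k * (n - k)))" by simp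
    then show "even ((-1) ^ k * 2 ^ (k * (n - k)) * int ((n - 1) choose (k - 1)) * c k)"
      by (intro dvd_mult2 dvd_mult)
  qed
  then have odd: "odd ((-1) ^ (n + 1) * (1 + ?s))"
    by simp
  have "n \<ge> 2" using n False by simp
  then have "c n = (-1) ^ (n + 1) * (1 + ?s)"
    using c unfolding rescaling_recursion_def by blast
  then have "odd (c n)" using odd by (rule ssubst)
  then show ?thesis by auto
qed

lemma rescaling_recursion_sum:
  assumes c: "rescaling_recursion c" and n: "n \<ge> 1"
  shows "(\<Sum>k=1..n. int ((n - 1) choose (k - 1)) * ((-1) ^ (k + 1) * c k * 2 ^ (k * (n - k)))) = 1"
proof -
  let ?t = "\<lambda>k. (-1) ^ k * 2 ^ (k * (n - k)) * int ((n - 1) choose (k - 1)) * c k"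
  have cn: "c n = (-1) ^ (n + 1) * (1 + (\<Sum>k = 1..n - 1. ?t k))"
  proof (cases "n = 1")
    case False
    then have "n \<ge> 2" using n by simp
    then show ?thesis using c unfolding rescaling_recursion_def by blast
  qed (use c in \<open>simp add: rescaling_recursion_def\<close>)
  have sign: "(-1) ^ (n + 1) * ((-1) ^ (n + 1) * z) = z" for z :: int
    by (simp flip: mult.assoc power_add)
  have "(\<Sum>k=1..n. int ((n - 1) choose (k - 1)) * ((-1) ^ (k + 1) * c k * 2 ^ (k * (n - k)))) =
      (\<Sum>k=1..n. - ?t k)"
    by (intro sum.cong) (auto simp: algebra_simps)
  also have "\<dots> = - ?t n - (\<Sum>k=1..n-1. ?t k)"
  proof -
    obtain l where "n = Suc l" using n by (cases n) auto
    then show ?thesis by (simp add: sum_negf)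
  qed
  also have "- ?t n = (-1) ^ (n + 1) * c n" by simp
  also have "(-1) ^ (n + 1) * c n = 1 + (\<Sum>k=1..n-1. ?t k)"
    by (subst cn) (rule sign)
  finally show ?thesis by simp
qed

text \<open>Up to sign and a power of two, \<open>c n\<close> is the sum of \<open>(-1/2)\<^bsup>|E|\<^esup>\<close> over the connected graphs on \<open>n\<close>
  vertices: both sides satisfy the recursion that expresses the sum \<open>(1 - 1/2)\<^bsup>n choose 2\<^esup>\<close> over all graphs by the component of a vertex.\<close>

lemma sum_connected_graphs:
  assumes c: "rescaling_recursion c"
  shows "finite V \<Longrightarrow> V \<noteq> {} \<Longrightarrow>
    (\<Sum>E\<in>connected_on V. (-1/2) ^ card E) =
      (-1) ^ (card V + 1) * of_int (c (card V)) / (2 ^ (card V choose 2) :: complex)"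
proof (induction "card V" arbitrary: V rule: less_induct)
  case less
  define \<beta> where "\<beta> k = (-1) ^ (k + 1) * of_int (c k) / (2 ^ (k choose 2) :: complex)" for k
  define b where "b S = (\<Sum>E\<in>connected_on S. (-1/2 :: complex) ^ card E)" for S :: "'a set"
  let ?n = "card V"
  let ?h = "\<lambda>k. (1 / 2 :: complex) ^ ((?n - k) choose 2)"
  obtain v where v: "v \<in> V" using less.prems by blast
  let ?A = "{S. S \<subseteq> V \<and> v \<in> S}"
  have fin: "finite ?A" "V \<in> ?A" using less.prems v by auto
  have n: "?n \<ge> 1" using less.prems by (simp add: Suc_leI card_gt_0_iff)
  have "(\<Sum>S\<in>?A. b S * ?h (card S)) = (1 / 2) ^ (?n choose 2)"
    using sum_power_card_graphs[OF less.prems(1) v, of "-1/2 :: complex"] by (simp add: b_def)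
  moreover have "(\<Sum>S\<in>?A. \<beta> (card S) * ?h (card S)) = (1 / 2) ^ (?n choose 2)"
  proof -
    have "(\<Sum>S\<in>?A. \<beta> (card S) * ?h (card S)) =
        (\<Sum>k=1..?n. of_nat ((?n - 1) choose (k - 1)) * (\<beta> k * ?h k))"
      by (rule sum_subsets_containing[OF less.prems(1) v])
    also have "\<dots> = (\<Sum>k=1..?n. (1 / 2) ^ (?n choose 2) *
        of_int (int ((?n - 1) choose (k - 1)) * ((-1) ^ (k + 1) * c k * 2 ^ (k * (?n - k)))))"
    proof (intro sum.cong refl)
      fix k assume "k \<in> {1..?n}"
      then have "?n choose 2 = (k choose 2) + ((?n - k) choose 2) + k * (?n - k)"
        using choose_two_add[of k "?n - k"] by simp
      then show "of_nat ((?n - 1) choose (k - 1)) * (\<beta> k * ?h k) = (1 / 2) ^ (?n choose 2) *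
        of_int (int ((?n - 1) choose (k - 1)) * ((-1) ^ (k + 1) * c k * 2 ^ (k * (?n - k))))"
        by (simp add: \<beta>_def power_add power_divide field_simps)
    qed
    also have "\<dots> = (1 / 2) ^ (?n choose 2)"
      unfolding sum_distrib_left[symmetric] of_int_sum[symmetric] rescaling_recursion_sum[OF c n] by simp
    finally show ?thesis .
  qed
  ultimately have "(\<Sum>S\<in>?A. b S * ?h (card S)) = (\<Sum>S\<in>?A. \<beta> (card S) * ?h (card S))" by simp
  \<comment> \<open>The induction hypothesis applies to all terms except the one with \<open>S = V\<close>, which is then determined.\<close>
  moreover have "(\<Sum>S\<in>?A - {V}. b S * ?h (card S)) = (\<Sum>S\<in>?A - {V}. \<beta> (card S) * ?h (card S))"
  proof (intro sum.cong refl)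
    fix S assume "S \<in> ?A - {V}"
    then have "S \<subset> V" "S \<noteq> {}" "finite S" using less.prems finite_subset[of S V] by auto
    then have "b S = \<beta> (card S)"
      using less.hyps[of S] psubset_card_mono[OF less.prems(1)] by (simp add: b_def \<beta>_def)
    then show "b S * ?h (card S) = \<beta> (card S) * ?h (card S)" by simp
  qed
  ultimately have "b V * ?h ?n = \<beta> ?n * ?h ?n"
    using sum.remove[OF fin, of "\<lambda>S. b S * ?h (card S)"]
      sum.remove[OF fin, of "\<lambda>S. \<beta> (card S) * ?h (card S)"] by simp
  then have "b V = \<beta> ?n" by (simp add: binomial_eq_0)
  then show ?case by (simp add: b_def \<beta>_def)
qed

section \<open>One-part Schur polynomials\<close>

text \<open>The sequence \<open>y\<close> with \<open>y\<^sub>k / k! = p\<^sub>k / k\<close>; the variable with index \<open>0\<close> is replaced by \<open>0\<close>.\<close>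

definition scaled_var :: "nat \<Rightarrow> mfps" where
  "scaled_var k = (if k = 0 then 0 else mfps_smult (fact (k - 1)) (mfps_var k))"

lemma homogeneous_scaled_var: "homogeneous k (scaled_var k)"
  by (auto simp: scaled_var_def intro: homogeneous_smult homogeneous_var homogeneous_0)

lemma power_sum_series_eq:
  "formal_sum {1..} (\<lambda>k::nat. mfps_smult (1 / of_nat k) (mfps_var k)) =
    graded_series (\<lambda>n. mfps_smult (1 / fact n) (scaled_var n))"
proof (rule mfps_eqI)
  fix m
  let ?f = "\<lambda>k::nat. mfps_smult (1 / of_nat k) (mfps_var k)"
  have "mfps_nth (?f k) m = 0" if "k \<noteq> wdeg m" for k
    using that homogeneous_var[of k] by (auto simp: homogeneous_def)
  then have "mfps_nth (formal_sum {1..} ?f) m = (\<Sum>k\<in>{wdeg m} \<inter> {1..}. mfps_nth (?f k) m)"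
    by (intro mfps_nth_formal_sum_finite) auto
  also have "\<dots> = mfps_nth (mfps_smult (1 / fact (wdeg m)) (scaled_var (wdeg m))) m"
    by (cases "wdeg m") (auto simp: scaled_var_def)
  finally show "mfps_nth (formal_sum {1..} ?f) m =
      mfps_nth (graded_series (\<lambda>n. mfps_smult (1 / fact n) (scaled_var n))) m" by simp
qed

lemma schur1_eq:
  assumes x: "\<And>n. homogeneous n (x n)" "x 0 = 1"
    and rec: "\<And>n. n \<ge> 1 \<Longrightarrow>
      x n = (\<Sum>k=1..n. of_nat ((n - 1) choose (k - 1)) * (scaled_var k * x (n - k)))"
  shows "schur1 (int n) = mfps_smult (1 / fact n) (x n)"
proof -
  have "mfps_exp (formal_sum {1..} (\<lambda>k::nat. mfps_smult (1 / of_nat k) (mfps_var k))) =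
      graded_series (\<lambda>n. mfps_smult (1 / fact n) (x n))"
    unfolding power_sum_series_eq
    by (rule exp_graded[OF x homogeneous_scaled_var _ rec]) (simp_all add: scaled_var_def)
  then show ?thesis
    using x(1)[of n] by (auto intro!: mfps_eqI simp: schur1_def wdeg_part_def homogeneous_def)
qed

text \<open>A component of size \<open>k\<close> contributes \<open>(-1)\<^bsup>k+1\<^esup> q\<^sub>k b\<^sub>k\<close>, where \<open>b\<^sub>k\<close> is the sum of \<open>(-1/2)\<^bsup>|E|\<^esup>\<close> over
  the connected graphs on \<open>k\<close> vertices.  The substitution turns this into \<open>(k - 1)! p\<^sub>k\<close>, so that the
  recursion by the component of a vertex becomes that of \<open>n!\<close> times the one-part Schur polynomial.\<close>

lemma rescaled_complete_edge_sum:
  assumes c: "rescaling_recursion c"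
    and a: "\<And>n. n \<ge> 1 \<Longrightarrow> a n = 2 ^ (n * (n - 1) div 2) * fact (n - 1) / of_int (c n)"
  shows "rescale_vars a (edge_sum mfps_var (\<lambda>_. 1) (- half) {..<n} (edges_on {..<n})) =
    mfps_smult (fact n) (schur1 (int n))"
proof -
  define R where "R V = rescale_vars a (edge_sum mfps_var (\<lambda>_. 1) (- half) V (edges_on V))"
    for V :: "nat set"
  have coeff: "rescale_vars a ((-1) ^ card S * - mfps_var (card S) * (\<Sum>E\<in>connected_on S. (- half) ^ card E))
      = scaled_var (card S)" if S: "finite S" "S \<noteq> {}" for S :: "nat set"
  proof -
    let ?k = "card S"
    have k: "?k \<ge> 1" using S by (simp add: Suc_leI card_gt_0_iff)
    have "(\<Sum>E\<in>connected_on S. (- half) ^ card E) =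
        mfps_smult (\<Sum>E\<in>connected_on S. (-1 / 2) ^ card E) 1"
      by (rule mfps_eqI) (simp add: uminus_half_power mfps_nth_sum)
    also have "\<dots> = mfps_smult ((-1) ^ (?k + 1) * of_int (c ?k) / 2 ^ (?k choose 2)) 1"
      unfolding sum_connected_graphs[OF c S] ..
    finally have b: "(\<Sum>E\<in>connected_on S. (- half) ^ card E) =
        mfps_smult ((-1) ^ (?k + 1) * of_int (c ?k) / 2 ^ (?k choose 2)) 1" .
    have neg: "(-1) ^ ?k * - mfps_var ?k = mfps_smult ((-1) ^ (?k + 1)) (mfps_var ?k)"
      using uminus_power_mfps[of 1 ?k] by (auto intro!: mfps_eqI simp: mfps_smult_mult)
    have const: "(-1) ^ (?k + 1) * ((-1) ^ (?k + 1) * of_int (c ?k) / 2 ^ (?k choose 2) * a ?k) = fact (?k - 1)"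
      using rescaling_recursion_nonzero[OF c k] a[OF k]
      by (simp add: choose_two field_simps flip: power_add mult_2)
    have resc: "rescale_vars a (mfps_smult s (mfps_var ?k) * mfps_smult t 1) =
        mfps_smult (s * (t * a ?k)) (mfps_var ?k)" for s t
      by (simp add: mfps_smult_mult mult_mfps_smult mfps_smult_smult rescale_vars_var mult_ac)
    show ?thesis
      unfolding b neg resc const scaled_var_def using k by simp
  qed
  \<comment> \<open>In the recursion for \<open>R\<close>, each component contributes the factor that occurs in that of \<open>n! s\<^sub>n\<close>.\<close>
  have rec: "R V = (\<Sum>S | S \<subseteq> V \<and> v \<in> S. scaled_var (card S) * R (V - S))"
    if V: "finite V" "v \<in> V" for V v
    unfolding R_def edge_sum_complete_recursion[OF V] rescale_vars_sum
  proof (intro sum.cong refl)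
    fix S assume "S \<in> {S. S \<subseteq> V \<and> v \<in> S}"
    then have S: "finite S" "S \<noteq> {}" using V finite_subset[of S V] by auto
    show "rescale_vars a ((-1) ^ card S * - mfps_var (card S) *
          (\<Sum>E\<in>connected_on S. (- half) ^ card E) *
          edge_sum mfps_var (\<lambda>_. 1) (- half) (V - S) (edges_on (V - S))) =
        scaled_var (card S) *
          rescale_vars a (edge_sum mfps_var (\<lambda>_. 1) (- half) (V - S) (edges_on (V - S)))"
      by (simp only: rescale_vars_mult flip: coeff[OF S])
  qed
  have "homogeneous 0 (- half)"
    by (simp add: homogeneous_def half_def)
  then have hom: "homogeneous n (R {..<n})" for n
    using homogeneous_edge_sum[of "{..<n}" "edges_on {..<n}" "- half"] edges_on_subset_Pow[of "{..<n}"]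
    by (auto simp: R_def homogeneous_def mfps_nth_rescale_vars)
  have "R {..<0} = 1" by (simp add: R_def edge_sum_no_edges)
  then have "schur1 (int n) = mfps_smult (1 / fact n) (R {..<n})"
    by (intro schur1_eq[of "\<lambda>n. R {..<n}"] hom card_recursion_lessThan[OF rec])
  then show ?thesis by (simp add: mfps_smult_smult R_def)
qed

lemma rescaled_W_all:
  assumes "rescaling_recursion c"
    and "\<And>n. n \<ge> 1 \<Longrightarrow> a n = 2 ^ (n * (n - 1) div 2) * fact (n - 1) / of_int (c n)"
  shows "rescale_vars a W_all = graded_series (\<lambda>n. mfps_smult (2 ^ (n choose 2)) (schur1 (int n)))"
proof (rule mfps_eqI)
  fix m
  let ?n = "wdeg m"
  have "mfps_nth (rescale_vars a W_all) m =
      mfps_nth (rescale_vars a (mfps_smult (1 / fact ?n) (chrom_sum {..<?n}))) m"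
    by (simp only: mfps_nth_rescale_vars W_all_eq mfps_nth_graded)
  also have "rescale_vars a (mfps_smult (1 / fact ?n) (chrom_sum {..<?n})) =
      mfps_smult (2 ^ (?n choose 2)) (schur1 (int ?n))"
    using rescaled_complete_edge_sum[OF assms, of ?n]
    by (simp add: chrom_sum_eq mfps_smult_smult)
  finally show "mfps_nth (rescale_vars a W_all) m =
      mfps_nth (graded_series (\<lambda>n. mfps_smult (2 ^ (n choose 2)) (schur1 (int n)))) m"
    by simp
qed

section \<open>Combinations of one-part Schur polynomials are tau functions\<close>

text \<open>The last row of the matrix vanishes, as a partition has no part \<open>0\<close>.\<close>

lemma wedge_coeff_several_parts:
  assumes \<beta>: "\<And>i k. i \<ge> 2 \<Longrightarrow> fls_nth (\<beta> i) k = (if k = - int i then 1 else 0)"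
    and \<mu>: "is_partition \<mu>" "length \<mu> \<ge> 2"
  shows "wedge_coeff \<beta> \<mu> = 0"
proof -
  let ?l = "length \<mu>"
  let ?A = "mat ?l ?l (\<lambda>(i, j). fls_nth (\<beta> (i + 1)) (int (\<mu> ! j) - int (j + 1)))"
  have l: "?l - 1 < ?l" "?l - 1 + 1 = ?l" using \<mu>(2) by auto
  have "?A $$ (?l - 1, j) = 0" if j: "j < ?l" for j
  proof -
    have "\<mu> ! j \<noteq> 0" using \<mu>(1) nth_mem[OF j] unfolding is_partition_def by metis
    then have "int (\<mu> ! j) - int (j + 1) \<noteq> - int ?l" using j by simp
    then have "fls_nth (\<beta> (?l - 1 + 1)) (int (\<mu> ! j) - int (j + 1)) = 0"
      unfolding l(2) using \<beta>[OF \<mu>(2)] by simp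
    then show ?thesis using j l(1) by simp
  qed
  then have "det ?A = 0"
    by (subst laplace_expansion_row[of ?A ?l, OF _ l(1)]) auto
  then show ?thesis by (simp only: wedge_coeff_def)
qed

lemma schur1_0: "schur1 0 = 1"
proof -
  have "order_ge 1 (graded_series (\<lambda>n. mfps_smult (1 / fact n) (scaled_var n)))"
    by (simp add: order_ge_def scaled_var_def)
  then show ?thesis
    unfolding schur1_def power_sum_series_eq
    by (auto intro!: mfps_eqI simp: wdeg_part_def mfps_nth_exp_degree_0)
qed

lemma homogeneous_schur1: "homogeneous n (schur1 (int n))"
  by (simp add: homogeneous_def schur1_def wdeg_part_def)

lemma schur_Nil: "schur [] = 1"
  by (simp add: schur_def det_dim_zero)

lemma schur_singleton: "schur [n] = schur1 (int n)"
  by (simp add: schur_def det_single)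

text \<open>Only \<open>\<beta>\<^sub>1\<close> differs from a power of \<open>z\<close>: it is \<open>\<Sum> d\<^sub>n z\<^bsup>n-1\<^esup>\<close>.\<close>

lemma KP_tau_one_part_schur:
  fixes d :: "nat \<Rightarrow> complex"
  assumes d: "d 0 = 1"
  shows "KP_tau_function (graded_series (\<lambda>n. mfps_smult (d n) (schur1 (int n))))"
proof -
  define \<beta> :: "nat \<Rightarrow> complex fls" where
    "\<beta> i = (if i = 1 then fls_shift 1 (fps_to_fls (Abs_fps d)) else fls_shift (int i) 1)" for i
  have \<beta>1: "fls_nth (\<beta> 1) k = (if k < -1 then 0 else d (nat (k + 1)))" for k
    by (simp add: \<beta>_def)
  have \<beta>2: "fls_nth (\<beta> i) k = (if k = - int i then 1 else 0)" if "i \<ge> 2" for i k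
    using that by (auto simp: \<beta>_def)
  have norm: "fls_nth (\<beta> i) (- int i) = 1 \<and> (\<forall>k < - int i. fls_nth (\<beta> i) k = 0)" if "i \<ge> 1" for i
    using that \<beta>1 \<beta>2[of i] d by (cases "i = 1") auto
  let ?f = "\<lambda>\<mu>. mfps_smult (wedge_coeff \<beta> \<mu>) (schur \<mu>)"
  have single: "?f [n] = mfps_smult (d n) (schur1 (int n))" for n
    using \<beta>1[of "int n - 1"] by (simp add: wedge_coeff_def det_single schur_singleton)
  have "graded_series (\<lambda>n. mfps_smult (d n) (schur1 (int n))) = formal_sum {\<mu>. is_partition \<mu>} ?f"
  proof (rule mfps_eqI)
    fix m
  \<comment> \<open>The only partition that contributes in degree \<open>wdeg m\<close>.\<close>
    let ?\<nu> = "if wdeg m = 0 then [] else [wdeg m]"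
    have "mfps_nth (?f \<mu>) m = 0" if \<mu>: "is_partition \<mu>" "\<mu> \<noteq> ?\<nu>" for \<mu>
    proof -
      consider "\<mu> = []" | n where "\<mu> = [n]" "n \<noteq> 0" | "length \<mu> \<ge> 2"
      proof (cases \<mu>)
        case (Cons n l)
        then show ?thesis using that \<mu> by (cases l) (auto simp: is_partition_def)
      qed (use that in simp)
      then show ?thesis
      proof cases
        case 1
        then show ?thesis using \<mu> by (auto simp: schur_Nil split: if_splits)
      next
        case 2
        then have "wdeg m \<noteq> n" using \<mu> by auto
        then show ?thesis
          using homogeneous_schur1[of n] unfolding 2 single by (auto simp: homogeneous_def)
      next
        case 3
        then show ?thesis using wedge_coeff_several_parts[of \<beta>, OF \<beta>2 \<mu>(1)] by simp
      qed
    qed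
    then have "mfps_nth (formal_sum {\<mu>. is_partition \<mu>} ?f) m = (\<Sum>\<mu>\<in>{?\<nu>}. mfps_nth (?f \<mu>) m)"
      by (intro mfps_nth_formal_sum_finite) (auto simp: is_partition_def)
    also have "\<dots> = mfps_nth (mfps_smult (d (wdeg m)) (schur1 (int (wdeg m)))) m"
    proof (cases "wdeg m = 0")
      case True
      then show ?thesis using d by (simp add: wedge_coeff_def det_dim_zero schur_Nil schur1_0)
    next
      case False
      have "mfps_nth (?f [wdeg m]) m = mfps_nth (mfps_smult (d (wdeg m)) (schur1 (int (wdeg m)))) m"
        by (simp only: single)
      then show ?thesis using False by simp
    qed
    finally show "mfps_nth (graded_series (\<lambda>n. mfps_smult (d n) (schur1 (int n)))) m =
        mfps_nth (formal_sum {\<mu>. is_partition \<mu>} ?f) m" by simp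
  qed
  then show ?thesis unfolding KP_tau_function_def using norm by blast
qed

theorem theorem2p1:
  fixes c :: "nat \<Rightarrow> int" and a :: "nat \<Rightarrow> complex"
  assumes "c 1 = 1"
    and "\<And>n. n \<ge> 2 \<Longrightarrow> c n = (-1) ^ (n + 1) *
           (1 + (\<Sum>k = 1..n - 1. (-1) ^ k * 2 ^ (k * (n - k)) * int ((n - 1) choose (k - 1)) * c k))"
    and "\<And>n. n \<ge> 1 \<Longrightarrow> a n = 2 ^ (n * (n - 1) div 2) * fact (n - 1) / of_int (c n)"
  shows "mfps_exp W_connected = W_all \<and>
         (\<forall>n\<ge>1. c n \<noteq> 0) \<and>
         KP_solution (rescale_vars a W_connected) \<and>
         KP_tau_function (rescale_vars a W_all)"
proof -
  have c: "rescaling_recursion c"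
    unfolding rescaling_recursion_def using assms(1,2) by blast
  have tau: "KP_tau_function (rescale_vars a W_all)"
  proof -
    have "rescale_vars a W_all = graded_series (\<lambda>n. mfps_smult (2 ^ (n choose 2)) (schur1 (int n)))"
      using assms(3) by (rule rescaled_W_all[OF c])
    moreover have "KP_tau_function \<dots>"
      by (rule KP_tau_one_part_schur) (simp add: binomial_eq_0)
    ultimately show ?thesis by simp
  qed
  have "order_ge 1 (rescale_vars a W_connected)"
    using order_ge_W_connected by (simp add: order_ge_def mfps_nth_rescale_vars)
  then have "mfps_ln (mfps_exp (rescale_vars a W_connected)) = rescale_vars a W_connected"
    by (rule mfps_ln_exp)
  then have "rescale_vars a W_connected = mfps_ln (rescale_vars a W_all)"
    using rescale_vars_exp[OF order_ge_W_connected, of a] exp_W_connected by simp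
  then have "KP_solution (rescale_vars a W_connected)"
    unfolding KP_solution_def using tau by blast
  then show ?thesis
    using tau exp_W_connected rescaling_recursion_nonzero[OF c] by blast
qed

end
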